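(* Let $W$ be a positive random variable with $\mathbf{E}[W^4]<\infty$ and $\mathbf{E}[W^2]<\mathbf{E}[W]$. Let $\mathcal{C}_{\min}^{(n)}$ and $\mathcal{C}_{\max}^{(n)}$ be the lengths of the shortest and the longest cycle, respectively, in the generalised random graph on $n$ vertices with weight distribution that of $W$, and let $\mathcal{S}$ and $\mathcal{L}$ be the $\{0,3,4,\dots\}$-valued random variables defined in the context. 1. There exists a constant $C>0$ such that for all $n\geq 3$, $$d_{Kol}(\mathcal{C}_{\min}^{(n)},\mathcal{S})\leq\frac{C\log(n)^3}{n}.$$ 2. There exists a constant $C>0$ such that for all $n\geq 3$, $$d_{Kol}(\mathcal{C}_{\max}^{(n)},\mathcal{L})\leq\frac{C\log(n)^3}{n}.$$
   Context: Generalised random graph: for $n\in\mathbb{N}$ the vertex set is $[n]=\{1,\dots,n\}$, the vertices carry i.i.d. weights $W_1,\dots,W_n$ distributed as the positive random variable $W$, and $L_n=\sum_{i=1}^n W_i$. Conditionally on the weights, any two distinct vertices $i,j\in[n]$ are joined by an edge independently with probability $\frac{W_iW_j}{W_iW_j+L_n}$. If the graph contains no cycle, the convention is $\mathcal{C}_{\max}^{(n)}=\mathcal{C}_{\min}^{(n)}=0$. For $k\in\mathbb{N}$, $\lambda_k=\frac{1}{2k}\left(\frac{\mathbf{E}[W^2]}{\mathbf{E}[W]}\right)^k$. The laws of the $\{0,3,4,\dots\}$-valued random variables $\mathcal{S}$ and $\mathcal{L}$ are given by $$\mathbf{P}(\mathcal{S}=0)=\mathbf{P}(\mathcal{L}=0)=\exp\Big(-\sum_{k=3}^\infty\lambda_k\Big)$$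 and, for all integers $t\geq 3$, $$\mathbf{P}(3\leq\mathcal{S}\leq t)=1-\exp\Big(-\sum_{k=3}^t\lambda_k\Big),\qquad \mathbf{P}(\mathcal{L}\leq t)=\exp\Big(-\sum_{k=t+1}^\infty\lambda_k\Big).$$ For random variables $X,Y$, the Kolmogorov distance is $d_{Kol}(X,Y)=\sup_{t\in\mathbb{R}}|\mathbf{P}(X\leq t)-\mathbf{P}(Y\leq t)|$. *)

theory Defs
  imports "HOL-Probability.Probability"
begin

definition possible_edges :: "nat \<Rightarrow> nat set set" where
  "possible_edges n = {e. e \<subseteq> {1..n} \<and> card e = 2}"

text \<open>For \<open>e = {i, j}\<close> with \<open>i \<noteq> j\<close>, the product over \<open>e\<close> is \<open>w i * w j\<close>.\<close>

definition edge_prob :: "nat \<Rightarrow> (nat \<Rightarrow> real) \<Rightarrow> nat set \<Rightarrow> real" where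
  "edge_prob n w e = (\<Prod>i\<in>e. w i) / ((\<Prod>i\<in>e. w i) + (\<Sum>i=1..n. w i))"

text \<open>Graphs on the vertex set \<open>{1..n}\<close> are identified with their edge sets. The following is the
  conditional law of the graph given the weights.\<close>

definition grg_given_weights :: "nat \<Rightarrow> (nat \<Rightarrow> real) \<Rightarrow> nat set set pmf" where
  "grg_given_weights n w =
     map_pmf (\<lambda>x. {e \<in> possible_edges n. x e})
       (Pi_pmf (possible_edges n) False (\<lambda>e. bernoulli_pmf (edge_prob n w e)))"

text \<open>The law of the generalised random graph when the i.i.d. weights have law \<open>D\<close>. All sets
  of graphs are measurable.\<close>

definition generalised_random_graph :: "real measure \<Rightarrow> nat \<Rightarrow> nat set set measure" where
  "generalised_random_graph D n =
     (\<Pi>\<^sub>M i\<in>{1..n}. D) \<bind> (\<lambda>w. measure_pmf (grg_given_weights n w))"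

definition is_cycle :: "'a set set \<Rightarrow> 'a list \<Rightarrow> bool" where
  "is_cycle E vs \<longleftrightarrow> 3 \<le> length vs \<and> distinct vs \<and>
     (\<forall>i<length vs. {vs ! i, vs ! (Suc i mod length vs)} \<in> E)"

definition cycle_lengths :: "'a set set \<Rightarrow> nat set" where
  "cycle_lengths E = {length vs | vs. is_cycle E vs}"

definition C_min :: "'a set set \<Rightarrow> nat" where
  "C_min E = (if cycle_lengths E = {} then 0 else Min (cycle_lengths E))"

definition C_max :: "'a set set \<Rightarrow> nat" where
  "C_max E = (if cycle_lengths E = {} then 0 else Max (cycle_lengths E))"

definition cycle_rate :: "'a measure \<Rightarrow> ('a \<Rightarrow> real) \<Rightarrow> nat \<Rightarrow> real" where
  "cycle_rate M W k =
     1 / (2 * real k) * ((\<integral>x. W x ^ 2 \<partial>M) / (\<integral>x. W x \<partial>M)) ^ k"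

definition shortest_limit_rv :: "(nat \<Rightarrow> real) \<Rightarrow> 'b measure \<Rightarrow> ('b \<Rightarrow> nat) \<Rightarrow> bool" where
  "shortest_limit_rv lam N S \<longleftrightarrow>
     prob_space N \<and> S \<in> N \<rightarrow>\<^sub>M count_space UNIV \<and>
     (AE x in N. S x = 0 \<or> 3 \<le> S x) \<and>
     measure N {x \<in> space N. S x = 0} = exp (- (\<Sum>\<^sub>\<infinity>k\<in>{3..}. lam k)) \<and>
     (\<forall>t\<ge>3. measure N {x \<in> space N. 3 \<le> S x \<and> S x \<le> t} = 1 - exp (- (\<Sum>k=3..t. lam k)))"

definition longest_limit_rv :: "(nat \<Rightarrow> real) \<Rightarrow> 'b measure \<Rightarrow> ('b \<Rightarrow> nat) \<Rightarrow> bool" where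
  "longest_limit_rv lam N L \<longleftrightarrow>
     prob_space N \<and> L \<in> N \<rightarrow>\<^sub>M count_space UNIV \<and>
     (AE x in N. L x = 0 \<or> 3 \<le> L x) \<and>
     measure N {x \<in> space N. L x = 0} = exp (- (\<Sum>\<^sub>\<infinity>k\<in>{3..}. lam k)) \<and>
     (\<forall>t\<ge>3. measure N {x \<in> space N. L x \<le> t} = exp (- (\<Sum>\<^sub>\<infinity>k\<in>{t+1..}. lam k)))"

definition kolmogorov_dist ::
  "'a measure \<Rightarrow> ('a \<Rightarrow> real) \<Rightarrow> 'b measure \<Rightarrow> ('b \<Rightarrow> real) \<Rightarrow> real" where
  "kolmogorov_dist M X N Y =
     (SUP t::real. \<bar>measure M {x \<in> space M. X x \<le> t} - measure N {y \<in> space N. Y y \<le> t}\<bar>)"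

end

theory Submission
  imports Defs
begin

text \<open>
  Both statistics are determined by events of the form that no cycle has its length in \<open>A\<close>, for sets
  \<open>A\<close> of lengths: the longest cycle has length at most \<open>t\<close> if and only if no length lies in
  \<open>{t + 1..}\<close>, and the law of the shortest cycle combines \<open>A = {3..}\<close> with \<open>A = {3..t}\<close>. The theorem
  therefore follows from one estimate, uniform in \<open>A\<close>: the probability of this event differs from
  \<open>exp (- (\<Sum>k\<in>A. \<lambda> k))\<close> by at most a constant times \<open>1 / n\<close> (\<open>no_cycle_estimate\<close>). This implies the
  asserted rate because \<open>ln n \<ge> 1\<close> for \<open>n \<ge> 3\<close>.

  Given the weights \<open>w\<close>, the edges are independent. Let \<open>L\<close> be the sum of the weights,
  \<open>\<rho> = (\<Sum> w\<^sup>2) / L\<close> and \<open>R = (\<Sum> w\<^sup>4) / L\<^sup>2\<close>. The cycles are taken into account one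
  after the other. Adding a cycle \<open>a\<close> multiplies the probability that no cycle is present by
  \<open>1 - P(a)\<close>, except for the effect of cycles that share an edge with \<open>a\<close>. A cycle of that kind
  contains an ear of \<open>a\<close>: a path outside \<open>a\<close> that joins two vertices of \<open>a\<close> (\<open>ear_path_exists\<close>). The
  ears are independent of the edges of \<open>a\<close>, so the error is at most \<open>P(a)\<close> times the probability that \<open>a\<close> has an
  ear (\<open>poisson_approx_no_occurrence\<close>). All sums over cycles become sums over lists of vertices of products of
  squared weights. Their main part is \<open>\<rho> ^ k / (2 * k)\<close> for length \<open>k\<close>, where \<open>2 * k\<close> is the number of
  lists of a cycle. The errors carry one fourth power of a weight in place of two squares, and are bounded by
  multiples of \<open>k * \<rho> ^ (k - 2) * R\<close>. If \<open>\<rho>\<close> stays below some \<open>q < 1\<close>, they are summable, and the conditional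
  probability is \<open>exp (- (\<Sum>k\<in>A. \<rho> ^ k / (2 * k)))\<close> up to a multiple of \<open>R\<close> (\<open>conditional_estimate\<close>).

  It remains to average over the weights. With \<open>\<theta> = E[W\<^sup>2] / E[W]\<close> one has \<open>\<rho> - \<theta> = Z / L\<close>, where
  \<open>Z\<close> is the sum of the centred independent variables \<open>w\<^sup>2 - \<theta> * w\<close>. Expanding around \<open>\<theta>\<close> to
  first order and replacing \<open>L\<close> by \<open>n * E[W]\<close> in the linear term leaves errors bounded by multiples of
  \<open>((\<Sum> w\<^sup>4) + (L - n * E[W])\<^sup>2 + Z\<^sup>2) / n\<^sup>2\<close>. The same expression dominates a constant
  when \<open>L\<close> is unusually small or \<open>\<rho>\<close> exceeds \<open>q\<close>, so that the bound holds for all weights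
  (\<open>pointwise_estimate\<close>). The linear term has expectation zero, and by the fourth moment assumption the errors
  have expectation of order \<open>1 / n\<close>.
\<close>

section \<open>Cycles as lists and as edge sets\<close>

definition cycle_edges :: "'a list \<Rightarrow> 'a set set" where
  "cycle_edges vs = (\<lambda>i. {vs ! i, vs ! (Suc i mod length vs)}) ` {..<length vs}"

definition cycle_list :: "'a list \<Rightarrow> bool" where
  "cycle_list vs \<longleftrightarrow> 3 \<le> length vs \<and> distinct vs"

definition path_edges :: "'a list \<Rightarrow> 'a set set" where
  "path_edges p = (\<lambda>i. {p ! i, p ! Suc i}) ` {..<length p - 1}"

lemma is_cycle_iff: "is_cycle E vs \<longleftrightarrow> cycle_list vs \<and> cycle_edges vs \<subseteq> E"
  by (auto simp: is_cycle_def cycle_list_def cycle_edges_def)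

lemma Suc_mod_neq: "3 \<le> k \<Longrightarrow> i < k \<Longrightarrow> Suc i mod k \<noteq> i \<and> Suc (Suc i mod k) mod k \<noteq> i"
  for i k :: nat
  by (auto simp: mod_Suc)

lemma inj_on_cycle_edge:
  assumes "cycle_list vs"
  shows "inj_on (\<lambda>i. {vs ! i, vs ! (Suc i mod length vs)}) {..<length vs}"
proof (rule inj_onI)
  fix i j
  assume i: "i \<in> {..<length vs}" and j: "j \<in> {..<length vs}"
    and eq: "{vs ! i, vs ! (Suc i mod length vs)} = {vs ! j, vs ! (Suc j mod length vs)}"
  have k: "3 \<le> length vs" "distinct vs" using assms by (auto simp: cycle_list_def)
  have lt: "Suc i mod length vs < length vs" "Suc j mod length vs < length vs"
    using k by (auto intro!: mod_less_divisor)
  show "i = j"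
  proof (rule ccontr)
    assume "i \<noteq> j"
    with eq i j k lt have "i = Suc j mod length vs" "Suc i mod length vs = j"
      by (auto simp: doubleton_eq_iff nth_eq_iff_index_eq)
    with Suc_mod_neq[OF k(1), of i] i show False by auto
  qed
qed

lemma card_cycle_edges: "cycle_list vs \<Longrightarrow> card (cycle_edges vs) = length vs"
  using inj_on_cycle_edge[of vs] by (simp add: cycle_edges_def card_image)

lemma finite_cycle_edges: "finite (cycle_edges vs)"
  by (simp add: cycle_edges_def)

lemma Union_cycle_edges: "\<Union> (cycle_edges vs) = set vs"
proof
  show "\<Union> (cycle_edges vs) \<subseteq> set vs"
    unfolding cycle_edges_def
    by (auto intro!: nth_mem mod_less_divisor) 
  show "set vs \<subseteq> \<Union> (cycle_edges vs)"
    by (auto simp: cycle_edges_def in_set_conv_nth)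
qed

lemma cycle_edge_neighbours:
  assumes "cycle_list vs" "i < length vs" "{vs ! i, x} \<in> cycle_edges vs"
  shows "x = vs ! (Suc i mod length vs) \<or>
         (\<exists>j<length vs. i = Suc j mod length vs \<and> x = vs ! j)"
proof -
  have k: "3 \<le> length vs" "distinct vs" using assms by (auto simp: cycle_list_def)
  obtain j where j: "j < length vs" "{vs ! i, x} = {vs ! j, vs ! (Suc j mod length vs)}"
    using assms(3) by (auto simp: cycle_edges_def)
  have lt: "Suc j mod length vs < length vs" using k by (auto intro!: mod_less_divisor)
  show ?thesis using j lt k assms(2)
    by (auto simp: doubleton_eq_iff nth_eq_iff_index_eq)
qed

text \<open>Walking along \<open>us\<close>, the next vertex is a neighbour of the current one
  in the cycle \<open>vs\<close> other than the vertex just left, and a vertex of a cycle has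
  only two neighbours. So \<open>us\<close> is forced to follow \<open>vs\<close>, and it can
  only close up where \<open>vs\<close> does. Only an inclusion of the edge sets is assumed,
  which makes the lemma serve both for counting the lists of a cycle and for excluding that one
  cycle lies properly inside another.\<close>

lemma cycle_list_determined:
  assumes us: "cycle_list us" and vs: "cycle_list vs"
    and sub: "cycle_edges us \<subseteq> cycle_edges vs"
    and 0: "us ! 0 = vs ! 0" and 1: "us ! 1 = vs ! 1"
  shows "us = vs"
proof -
  have k: "3 \<le> length vs" "distinct vs" using vs by (auto simp: cycle_list_def)
  have l: "3 \<le> length us" "distinct us" using us by (auto simp: cycle_list_def)
  have step: "Suc i < length us \<longrightarrow>
      Suc i < length vs \<and> us ! i = vs ! i \<and> us ! Suc i = vs ! Suc i" for i
  proof (induction i)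
    case 0
    then show ?case using k l assms(4,5) by simp
  next
    case (Suc i)
    show ?case
    proof
      assume lt: "Suc (Suc i) < length us"
      have IH: "Suc i < length vs" "us ! i = vs ! i" "us ! Suc i = vs ! Suc i"
        using Suc lt by auto
      have "{us ! Suc i, us ! Suc (Suc i)} \<in> cycle_edges us"
        unfolding cycle_edges_def using lt by (intro image_eqI[of _ _ "Suc i"]) auto
      hence e: "{vs ! Suc i, us ! Suc (Suc i)} \<in> cycle_edges vs" using IH sub by auto
      have ne: "us ! Suc (Suc i) \<noteq> vs ! i" "us ! Suc (Suc i) \<noteq> vs ! 0"
        using nth_eq_iff_index_eq[OF l(2), of "Suc (Suc i)" i]
          nth_eq_iff_index_eq[OF l(2), of "Suc (Suc i)" 0] lt l IH(2) 0
        by (auto simp del: length_greater_0_conv)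
      have "us ! Suc (Suc i) = vs ! (Suc (Suc i) mod length vs)"
      proof (rule ccontr)
        assume "us ! Suc (Suc i) \<noteq> vs ! (Suc (Suc i) mod length vs)"
        \<comment> \<open>the only other neighbour of \<open>vs ! Suc i\<close> is
          \<open>vs ! i\<close>, which \<open>us\<close> has already visited\<close>
        then obtain j where "j < length vs" "Suc i = Suc j mod length vs"
            "us ! Suc (Suc i) = vs ! j"
          using cycle_edge_neighbours[OF vs IH(1) e] by auto
        with ne show False by (auto simp: mod_Suc split: if_splits)
      qed
      moreover from this ne have "Suc (Suc i) < length vs"
        using IH(1) by (cases "Suc (Suc i) = length vs") auto
      ultimately show "Suc (Suc i) < length vs \<and> us ! Suc i = vs ! Suc i \<and>
          us ! Suc (Suc i) = vs ! Suc (Suc i)" using IH by simp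
    qed
  qed
  have "Suc (length us - 2) < length us" using l(1) by linarith
  hence "Suc (length us - 2) < length vs" using step by blast
  hence le: "length us \<le> length vs" using l(1) by linarith
  have eq: "us ! i = vs ! i" if "i < length us" for i
    using step[of "i - 1"] that 0 by (cases i) auto
  have "{us ! (length us - 1), us ! 0} \<in> cycle_edges us"
    unfolding cycle_edges_def
  proof (intro image_eqI[of _ _ "length us - 1"])
    have "Suc (length us - 1) = length us" using l(1) by linarith
    thus "{us ! (length us - 1), us ! 0} = {us ! (length us - 1), us ! (Suc (length us - 1) mod length us)}"
      by simp
  qed (use l(1) in simp)
  hence closing: "{vs ! (length us - 1), vs ! 0} \<in> cycle_edges vs"
    using sub eq[of "length us - 1"] 0 l by auto
  have lt: "length us - 1 < length vs" and Suc: "Suc (length us - 1) = length us"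
    using le l(1) by linarith+
  have "\<not> (\<exists>j<length vs. length us - 1 = Suc j mod length vs \<and> vs ! 0 = vs ! j)"
  proof
    assume "\<exists>j<length vs. length us - 1 = Suc j mod length vs \<and> vs ! 0 = vs ! j"
    then obtain j where j: "j < length vs" "length us - 1 = Suc j mod length vs" "vs ! 0 = vs ! j"
      by blast
    have "0 < length vs" using k(1) by linarith
    from nth_eq_iff_index_eq[OF k(2) j(1) this] j(3) have "j = 0" by simp
    moreover have "Suc 0 mod length vs = Suc 0" using k(1) by simp
    ultimately have "length us - 1 = 1" using j(2) by simp
    with l(1) show False by linarith
  qed
  with cycle_edge_neighbours[OF vs lt closing] have "vs ! 0 = vs ! (length us mod length vs)"
    unfolding Suc by blast
  hence "length us mod length vs = 0" using k
    by (subst (asm) nth_eq_iff_index_eq) (auto intro!: mod_less_divisor)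
  with le l have "length us = length vs" by (cases "length us = length vs") auto
  with eq show ?thesis by (intro nth_equalityI) auto
qed

lemma cycle_edges_rotate:
  assumes "cycle_list vs"
  shows "cycle_edges (rotate m vs) = cycle_edges vs"
proof -
  have c: "cycle_list (rotate m vs)" using assms by (simp add: cycle_list_def)
  have "cycle_edges (rotate m vs) \<subseteq> cycle_edges vs"
  proof
    fix e assume "e \<in> cycle_edges (rotate m vs)"
    then obtain i where i: "i < length vs" "e = {rotate m vs ! i, rotate m vs ! (Suc i mod length vs)}"
      by (auto simp: cycle_edges_def)
    have lt: "Suc i mod length vs < length vs" "(m + i) mod length vs < length vs"
      using i by (auto intro!: mod_less_divisor)
    have "e = {vs ! ((m + i) mod length vs), vs ! (Suc ((m + i) mod length vs) mod length vs)}"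
      unfolding i(2) nth_rotate[OF i(1)] nth_rotate[OF lt(1)] by (simp add: mod_simps)
    thus "e \<in> cycle_edges vs" using lt(2) by (auto simp: cycle_edges_def)
  qed
  thus ?thesis using card_cycle_edges[OF c] card_cycle_edges[OF assms]
    by (intro card_subset_eq finite_cycle_edges) auto
qed

lemma cycle_edges_rev:
  assumes "cycle_list vs"
  shows "cycle_edges (rev vs) = cycle_edges vs"
proof -
  have c: "cycle_list (rev vs)" and k: "3 \<le> length vs" using assms by (auto simp: cycle_list_def)
  have "cycle_edges (rev vs) \<subseteq> cycle_edges vs"
  proof
    fix e assume "e \<in> cycle_edges (rev vs)"
    then obtain i where i: "i < length vs" "e = {rev vs ! i, rev vs ! (Suc i mod length vs)}"
      by (auto simp: cycle_edges_def)
    define j where "j = (if Suc i = length vs then length vs - 1 else length vs - 2 - i)"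
    have j: "j < length vs" using k by (auto simp: j_def)
    have "e = {vs ! j, vs ! (Suc j mod length vs)}"
    proof (cases "Suc i = length vs")
      case True
      hence "j = i" using k by (auto simp: j_def)
      moreover from this True have "Suc j mod length vs = 0" by simp
      moreover have "length vs - Suc i = 0" "length vs - Suc 0 = i" "0 < length vs"
        using True by linarith+
      hence "rev vs ! i = vs ! 0" "rev vs ! 0 = vs ! i"
        using rev_nth[of i vs] rev_nth[of 0 vs] i(1) by metis+
      ultimately show ?thesis using i(2) True by (simp add: insert_commute)
    next
      case False
      hence "Suc j = length vs - Suc i" "j = length vs - Suc (Suc i)" "Suc i < length vs"
        using i k by (auto simp: j_def)
      thus ?thesis using i by (simp add: rev_nth insert_commute)
    qed
    with j show "e \<in> cycle_edges vs" by (auto simp: cycle_edges_def)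
  qed
  thus ?thesis using card_cycle_edges[OF c] card_cycle_edges[OF assms]
    by (intro card_subset_eq finite_cycle_edges) auto
qed

text \<open>A cycle can be traversed starting along any of its edges, in either direction:
  rotate, and for the backward direction reverse as well.\<close>

lemma cycle_list_starting_at:
  assumes vs: "cycle_list vs" and e: "{u, v} \<in> cycle_edges vs"
  obtains us where "cycle_list us" "cycle_edges us = cycle_edges vs" "us ! 0 = u" "us ! 1 = v"
proof -
  have k: "3 \<le> length vs" "distinct vs" using vs by (auto simp: cycle_list_def)
  obtain i where i: "i < length vs" "{u, v} = {vs ! i, vs ! (Suc i mod length vs)}"
    using e by (auto simp: cycle_edges_def)
  consider "u = vs ! i" "v = vs ! (Suc i mod length vs)"
    | "v = vs ! i" "u = vs ! (Suc i mod length vs)"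
    using i(2) by (auto simp: doubleton_eq_iff)
  thus thesis
  proof cases
    case 1
    have "vs \<noteq> []" using k by auto
    thus thesis using 1 
      by (intro that[of "rotate i vs"])
        (use vs k i nth_rotate[of 0 vs i] nth_rotate[of 1 vs i] in
          \<open>auto simp: cycle_edges_rotate cycle_list_def\<close>)
  next
    case 2
    have r: "cycle_list (rotate (i + 2) vs)" using vs by (simp add: cycle_list_def)
    \<comment> \<open>rotating by \<open>i + 2\<close> puts \<open>vs ! i\<close> and its
      successor last, so reversal puts them first in the opposite order\<close>
    have *: "i + 2 + (length vs - 1) = Suc i + length vs" "i + 2 + (length vs - 2) = i + length vs"
      using k by auto
    show thesis
    proof (rule that[of "rev (rotate (i + 2) vs)"])
      show "cycle_edges (rev (rotate (i + 2) vs)) = cycle_edges vs"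
        by (simp only: cycle_edges_rev[OF r] cycle_edges_rotate[OF vs])
      show "rev (rotate (i + 2) vs) ! 0 = u"
        using rev_nth[of 0 "rotate (i + 2) vs"] nth_rotate[of "length vs - 1" vs "i + 2"] 2 k *(1)
          mod_add_self2[of "Suc i" "length vs"]
        by (auto simp del: rotate_Suc add_2_eq_Suc' length_greater_0_conv)
      show "rev (rotate (i + 2) vs) ! 1 = v"
        using rev_nth[of 1 "rotate (i + 2) vs"] nth_rotate[of "length vs - 2" vs "i + 2"] 2 k *(2) i
        by (auto simp: numeral_2_eq_2 simp del: rotate_Suc add_2_eq_Suc')
      show "cycle_list (rev (rotate (i + 2) vs))" using r by (simp add: cycle_list_def)
    qed
  qed
qed

lemma cycle_edges_subset_imp_eq:
  assumes us: "cycle_list us" and vs: "cycle_list vs"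
    and sub: "cycle_edges us \<subseteq> cycle_edges vs"
  shows "cycle_edges us = cycle_edges vs"
proof -
  have "{us ! 0, us ! 1} \<in> cycle_edges us"
    unfolding cycle_edges_def using us
    by (intro image_eqI[of _ _ 0]) (auto simp: cycle_list_def)
  hence "{us ! 0, us ! 1} \<in> cycle_edges vs" using sub by blast
  from cycle_list_starting_at[OF vs this] obtain vs' where
    "cycle_list vs'" "cycle_edges vs' = cycle_edges vs" "vs' ! 0 = us ! 0" "vs' ! 1 = us ! 1" .
  with cycle_list_determined[OF us, of vs'] sub show ?thesis by auto
qed

text \<open>This count is the factor \<open>1 / (2 * k)\<close> in the rates. A list is
  determined by its first two vertices, and these can be the two ends of any of the
  \<open>k\<close> edges in either order.\<close>

lemma card_cycle_lists:
  assumes vs: "cycle_list vs"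
  shows "card {us. cycle_list us \<and> cycle_edges us = cycle_edges vs} = 2 * length vs"
proof -
  have k: "3 \<le> length vs" "distinct vs" using vs by (auto simp: cycle_list_def)
  let ?k = "length vs" and ?s = "\<lambda>i. Suc i mod length vs"
  let ?A = "(\<lambda>i. (vs ! i, vs ! ?s i)) ` {..<?k}" and ?B = "(\<lambda>i. (vs ! ?s i, vs ! i)) ` {..<?k}"
  have lt: "?s i < ?k" for i using k by (auto intro!: mod_less_divisor)
  have inj: "inj_on (\<lambda>i. (vs ! i, vs ! ?s i)) {..<?k}" "inj_on (\<lambda>i. (vs ! ?s i, vs ! i)) {..<?k}"
    using k by (auto simp: inj_on_def nth_eq_iff_index_eq)
  have disj: "?A \<inter> ?B = {}"
    using k lt Suc_mod_neq[OF k(1)] by (auto simp: nth_eq_iff_index_eq)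
  have "bij_betw (\<lambda>us. (us ! 0, us ! 1)) {us. cycle_list us \<and> cycle_edges us = cycle_edges vs} (?A \<union> ?B)"
  proof (rule bij_betw_imageI)
    show "inj_on (\<lambda>us. (us ! 0, us ! 1)) {us. cycle_list us \<and> cycle_edges us = cycle_edges vs}"
      by (auto intro!: inj_onI cycle_list_determined)
    have pair: "(u, v) \<in> ?A \<union> ?B \<longleftrightarrow> {u, v} \<in> cycle_edges vs" for u v
      by (auto simp: cycle_edges_def doubleton_eq_iff)
    show "(\<lambda>us. (us ! 0, us ! 1)) ` {us. cycle_list us \<and> cycle_edges us = cycle_edges vs} = ?A \<union> ?B"
    proof (intro set_eqI iffI)
      fix x assume "x \<in> (\<lambda>us. (us ! 0, us ! 1)) ` {us. cycle_list us \<and> cycle_edges us = cycle_edges vs}"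
      then obtain us where us: "cycle_list us" "cycle_edges us = cycle_edges vs" "x = (us ! 0, us ! 1)"
        by auto
      have "{us ! 0, us ! 1} \<in> cycle_edges us"
        unfolding cycle_edges_def using us
        by (intro image_eqI[of _ _ 0]) (auto simp: cycle_list_def)
      thus "x \<in> ?A \<union> ?B" unfolding us(2,3) pair .
    next
      fix x assume "x \<in> ?A \<union> ?B"
      then obtain u v where x: "x = (u, v)" "{u, v} \<in> cycle_edges vs" using pair by (cases x) auto
      from cycle_list_starting_at[OF vs x(2)]
      show "x \<in> (\<lambda>us. (us ! 0, us ! 1)) ` {us. cycle_list us \<and> cycle_edges us = cycle_edges vs}"
        using x(1) by (metis (mono_tags, lifting) image_eqI mem_Collect_eq)
    qed
  qed
  hence "card {us. cycle_list us \<and> cycle_edges us = cycle_edges vs} = card (?A \<union> ?B)"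
    by (rule bij_betw_same_card)
  also have "\<dots> = card ?A + card ?B" using disj by (intro card_Un_disjoint) auto
  also have "\<dots> = 2 * ?k" using inj by (simp add: card_image)
  finally show ?thesis .
qed

text \<open>The dependence between two cycles that share an edge is controlled by a path that
  meets the second cycle \<open>vs\<close> in its two ends and uses none of its edges. To find
  it, start on \<open>us\<close> along a common edge, wait for the first edge that leaves
  \<open>vs\<close>, and stop at the first return to a vertex of \<open>vs\<close>; the walk
  returns at the latest when \<open>us\<close> closes up.\<close>

lemma ear_path_exists:
  assumes us: "cycle_list us" and vs: "cycle_list vs"
    and ne: "cycle_edges us \<noteq> cycle_edges vs" and meet: "cycle_edges us \<inter> cycle_edges vs \<noteq> {}"
  shows "\<exists>p. 2 \<le> length p \<and> distinct p \<and> set p \<subseteq> set us \<and> p ! 0 \<in> set vs \<and> p ! (length p - 1) \<in> set vs \<and>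
             path_edges p \<subseteq> cycle_edges us - cycle_edges vs"
proof -
  have k: "3 \<le> length us" "distinct us" using us by (auto simp: cycle_list_def)
  obtain e where e: "e \<in> cycle_edges us" "e \<in> cycle_edges vs" using meet by auto
  then obtain u v where uv: "e = {u, v}" by (auto simp: cycle_edges_def)
  obtain bs where bs: "cycle_list bs" "cycle_edges bs = cycle_edges us" "bs ! 0 = u" "bs ! 1 = v"
    using cycle_list_starting_at[OF us] e uv by metis
  have l: "3 \<le> length bs" "distinct bs" using bs by (auto simp: cycle_list_def)
  have set_bs: "set bs = set us" using bs(2) Union_cycle_edges by metis
  let ?l = "length bs" and ?E = "cycle_edges vs" and ?V = "set vs"
  let ?e = "\<lambda>i. {bs ! i, bs ! (Suc i mod length bs)}"
  have V: "x \<in> ?V" if "{x, y} \<in> ?E" for x y using that Union_cycle_edges[of vs] by auto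
  have "\<not> cycle_edges us \<subseteq> ?E" using cycle_edges_subset_imp_eq[OF us vs] ne by auto
  then obtain i0 where i0: "i0 < ?l" "?e i0 \<notin> ?E" unfolding bs(2)[symmetric] by (auto simp: cycle_edges_def)
  define i where "i = (LEAST i. ?e i \<notin> ?E)"
  have i: "?e i \<notin> ?E" unfolding i_def using i0(2) by (rule LeastI)
  have il: "i < ?l" using Least_le[of "\<lambda>i. ?e i \<notin> ?E", OF i0(2)] i0(1) by (simp add: i_def)
  have e0: "?e 0 \<in> ?E" using e uv bs l by auto
  have ipos: "i \<noteq> 0" using i e0 by metis
  then obtain i' where i': "i = Suc i'" by (cases i) auto
  have "?e i' \<in> ?E" using not_less_Least[of i' "\<lambda>i. ?e i \<notin> ?E"] i' by (auto simp flip: i_def)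
  hence iV: "bs ! i \<in> ?V" using V[of "bs ! i" "bs ! i'"] i' il by (simp add: insert_commute)
  \<comment> \<open>the index \<open>?l\<close> stands for the return to the starting vertex
    \<open>bs ! 0\<close>\<close>
  let ?b = "\<lambda>j. bs ! (j mod ?l)"
  have lV: "i < ?l \<and> ?b ?l \<in> ?V" using V[of "bs ! 0" "bs ! 1"] e uv bs il l by auto
  define j where "j = (LEAST j. i < j \<and> ?b j \<in> ?V)"
  have j: "i < j" "?b j \<in> ?V"
    using LeastI[of "\<lambda>j. i < j \<and> ?b j \<in> ?V", OF lV] by (auto simp: j_def)
  have jl: "j \<le> ?l" using Least_le[of "\<lambda>j. i < j \<and> ?b j \<in> ?V", OF lV] by (simp add: j_def)
  have between: "?b m \<notin> ?V" if "i < m" "m < j" for m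
    using not_less_Least[of m "\<lambda>j. i < j \<and> ?b j \<in> ?V"] that by (auto simp flip: j_def)
  define p where "p = map ?b [i..<Suc j]"
  have lp: "length p = Suc j - i" using j by (simp add: p_def Suc_diff_le)
  have nth: "p ! m = ?b (i + m)" if "m \<le> j - i" for m
    using that j by (simp add: p_def del: upt_Suc) (subst nth_upt, auto)
  have injb: "inj_on ?b {i..j}"
  proof (rule inj_onI)
    fix x y assume xy: "x \<in> {i..j}" "y \<in> {i..j}" "?b x = ?b y"
    have "x mod ?l = y mod ?l"
      using xy(3) l by (subst (asm) nth_eq_iff_index_eq) (auto intro!: mod_less_divisor)
    with xy ipos jl show "x = y"
      by (cases "x = ?l"; cases "y = ?l") auto
  qed
  show ?thesis
  proof (intro exI[of _ p] conjI)
    show "2 \<le> length p" using j lp by (simp add: Suc_diff_le)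
    show "distinct p" unfolding p_def distinct_map using injb
      by (auto simp: atLeastLessThanSuc_atLeastAtMost simp del: upt_Suc)
    show "set p \<subseteq> set us" unfolding set_bs[symmetric]  using l by (auto simp: p_def intro!: nth_mem mod_less_divisor simp del: upt_Suc)
    show "p ! 0 \<in> ?V" using nth[of 0] iV il by simp
    show "p ! (length p - 1) \<in> ?V" using nth[of "j - i"] lp j by simp
    show "path_edges p \<subseteq> cycle_edges us - ?E"
    proof
      fix f assume "f \<in> path_edges p"
      then obtain m where m: "m < j - i" "f = {p ! m, p ! Suc m}"
        using lp by (auto simp: path_edges_def)
      have f: "f = {?b (i + m), ?b (Suc (i + m))}" using m nth[of m] nth[of "Suc m"] by simp
      have lt: "i + m < ?l" using m jl by simp
      hence fe: "f = ?e (i + m)" using f by simp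
      have "f \<in> cycle_edges us" unfolding bs(2)[symmetric] unfolding cycle_edges_def fe using lt by auto
      moreover have "f \<notin> ?E"
      proof (cases "m = 0")
        case True
        thus ?thesis using fe i by simp
      next
        case False
        hence "?b (i + m) \<notin> ?V" using between[of "i + m"] m by auto
        thus ?thesis using f V by blast
      qed
      ultimately show "f \<in> cycle_edges us - ?E" by simp
    qed
  qed
qed

section \<open>Poisson approximation for independent edges\<close>

definition bernoulli_subset :: "'a set \<Rightarrow> ('a \<Rightarrow> real) \<Rightarrow> 'a set pmf" where
  "bernoulli_subset E p = map_pmf (\<lambda>x. {e \<in> E. x e}) (Pi_pmf E False (\<lambda>e. bernoulli_pmf (p e)))"

text \<open>The random edge set is built one edge at a time, which turns the independence
  statements below into inductions.\<close>

lemma bernoulli_subset_insert: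
  assumes "finite E" "e \<notin> E"
  shows "bernoulli_subset (insert e E) p =
    map_pmf (\<lambda>(b, X). if b then insert e X else X) (pair_pmf (bernoulli_pmf (p e)) (bernoulli_subset E p))"
  unfolding bernoulli_subset_def using assms
  by (subst Pi_pmf_insert)
     (auto simp: pair_map_pmf2 map_pmf_comp case_prod_beta intro!: map_pmf_cong split: if_splits)

lemma prob_edge_and_rest:
  assumes "finite E" "e \<in> E" "0 \<le> p e" "p e \<le> 1"
  shows "measure_pmf.prob (bernoulli_subset E p) {X. e \<in> X \<and> B (X - {e})} =
         p e * measure_pmf.prob (bernoulli_subset E p) {X. B (X - {e})}"
proof -
  define F where "F = E - {e}"
  have E: "E = insert e F" "finite F" "e \<notin> F" using assms by (auto simp: F_def)
  let ?Q = "pair_pmf (bernoulli_pmf (p e)) (bernoulli_subset F p)"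
  have sub: "set_pmf (bernoulli_subset F p) \<subseteq> Pow F"
    by (auto simp: bernoulli_subset_def)
  have notin: "e \<notin> X" if "X \<in> set_pmf (bernoulli_subset F p)" for X
    using sub that E by auto
  have "measure_pmf.prob (bernoulli_subset E p) {X. e \<in> X \<and> B (X - {e})} =
        measure_pmf.prob ?Q ({True} \<times> {X \<in> Pow F. B X})"
    unfolding E(1) bernoulli_subset_insert[OF E(2,3)] measure_map_pmf
    by (rule measure_pmf.finite_measure_eq_AE; auto simp: AE_measure_pmf_iff split: if_splits dest: notin subsetD[OF sub])
  also have "\<dots> = p e * measure_pmf.prob (bernoulli_subset F p) {X \<in> Pow F. B X}"
    using assms E by (subst measure_pmf_prob_product) (auto intro: countable_finite simp: measure_pmf_single)
  also have "measure_pmf.prob (bernoulli_subset F p) {X \<in> Pow F. B X} =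
      measure_pmf.prob ?Q (UNIV \<times> {X \<in> Pow F. B X})"
    using E by (subst measure_pmf_prob_product) (auto intro: countable_finite)
  also have "\<dots> = measure_pmf.prob (bernoulli_subset E p) {X. B (X - {e})}"
    unfolding E(1) bernoulli_subset_insert[OF E(2,3)] measure_map_pmf
    by (rule measure_pmf.finite_measure_eq_AE; auto simp: AE_measure_pmf_iff split: if_splits dest: notin subsetD[OF sub])
  finally show ?thesis .
qed

text \<open>The presence of the edges \<open>F\<close> is independent of every event that looks
  only at the other edges; such an event is written as \<open>B (X - F)\<close>.\<close>

lemma prob_contains_and_rest:
  assumes "finite E" "F \<subseteq> E" "\<And>e. e \<in> E \<Longrightarrow> 0 \<le> p e \<and> p e \<le> 1"
  shows "measure_pmf.prob (bernoulli_subset E p) {X. F \<subseteq> X \<and> B (X - F)} =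
         (\<Prod>e\<in>F. p e) * measure_pmf.prob (bernoulli_subset E p) {X. B (X - F)}"
proof -
  have "finite F" using assms finite_subset by auto
  from this assms(2) show ?thesis
  proof (induction F arbitrary: B rule: finite_induct)
    case empty
    then show ?case by simp
  next
    case (insert e F)
    have diff: "X - insert e F = X - {e} - F" "X - insert e F = X - F - {e}" for X by auto
    have "{X. insert e F \<subseteq> X \<and> B (X - insert e F)} = {X. e \<in> X \<and> (F \<subseteq> X - {e} \<and> B (X - {e} - F))}"
      using insert by (auto simp: diff)
    also have "measure_pmf.prob (bernoulli_subset E p) \<dots> =
        p e * measure_pmf.prob (bernoulli_subset E p) {X. F \<subseteq> X - {e} \<and> B (X - {e} - F)}"
      using insert assms by (intro prob_edge_and_rest) auto
    also have "{X. F \<subseteq> X - {e} \<and> B (X - {e} - F)} = {X. F \<subseteq> X \<and> B (X - F - {e})}"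
      using insert by (auto simp: diff[symmetric])
    finally show ?case using insert.IH[of "\<lambda>Y. B (Y - {e})"] insert.prems insert.hyps diff
      by (simp add: mult.assoc)
  qed
qed

lemma prob_contains:
  assumes "finite E" "F \<subseteq> E" "\<And>e. e \<in> E \<Longrightarrow> 0 \<le> p e \<and> p e \<le> 1"
  shows "measure_pmf.prob (bernoulli_subset E p) {X. F \<subseteq> X} = (\<Prod>e\<in>F. p e)"
  using prob_contains_and_rest[OF assms, where B = "\<lambda>_. True"] by simp

lemma one_minus_exp_bounds:
  fixes x :: real assumes "0 \<le> x" 
  shows "\<bar>exp (- x) - (1 - x)\<bar> \<le> x\<^sup>2"
proof -
  have "1 - x \<le> exp (-x)" using exp_ge_add_one_self[of "-x"] by simp
  moreover have "exp (-x) \<le> 1 - x + x\<^sup>2"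
  proof -
    have "exp (-x) \<le> 1 / (1 + x)"
      using exp_ge_add_one_self[of x] assms by (simp add: exp_minus field_simps)
    also have "\<dots> \<le> 1 - x + x\<^sup>2"
      using assms by (simp add: field_simps power2_eq_square)
    finally show ?thesis .
  qed
  ultimately show ?thesis by simp
qed

text \<open>A Poisson approximation for the event that none of the sets \<open>a \<in> I\<close>
  is contained in the random set. When \<open>a\<close> is added to the index family, the
  probability is multiplied by \<open>1 - P(a)\<close> up to an error: the members disjoint from
  \<open>a\<close> are independent of \<open>a\<close>, and the members that meet
  \<open>a\<close> can only occur if \<open>U a\<close> does, where \<open>U a\<close> looks at
  elements outside \<open>a\<close> and so is independent of \<open>a\<close> as well. The error
  \<open>P(a) * P(U a)\<close> thus needs no joint probabilities of pairs and no correlation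
  inequality. The squares come from replacing \<open>1 - P(a)\<close> by \<open>exp (-
  P(a))\<close>.\<close>

lemma poisson_approx_no_occurrence:
  assumes "finite E" "\<And>e. e \<in> E \<Longrightarrow> 0 \<le> p e \<and> p e \<le> 1"
    and "finite I" "\<And>a. a \<in> I \<Longrightarrow> a \<subseteq> E"
    and U: "\<And>a b X. a \<in> I \<Longrightarrow> b \<in> I \<Longrightarrow> a \<noteq> b \<Longrightarrow> a \<inter> b \<noteq> {} \<Longrightarrow> b \<subseteq> X \<Longrightarrow> U a (X - a)"
  shows "\<bar>measure_pmf.prob (bernoulli_subset E p) {X. \<forall>a\<in>I. \<not> a \<subseteq> X} - exp (- (\<Sum>a\<in>I. \<Prod>e\<in>a. p e))\<bar>
    \<le> (\<Sum>a\<in>I. (\<Prod>e\<in>a. p e) * measure_pmf.prob (bernoulli_subset E p) {X. U a (X - a)} + (\<Prod>e\<in>a. p e)\<^sup>2)"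
  using assms(3) assms(4) U
proof (induction I rule: finite_induct)
  case empty
  then show ?case by simp
next
  case (insert a J)
  let ?P = "measure_pmf.prob (bernoulli_subset E p)"
  define q where "q = (\<Prod>e\<in>a. p e)"
  define N where "N = {X. \<forall>b\<in>J. \<not> b \<subseteq> X}"
  define N' where "N' = {X. \<forall>b\<in>J. b \<inter> a = {} \<longrightarrow> \<not> b \<subseteq> X}"
  define V where "V = {X. U a (X - a)}"
  let ?s = "\<Sum>b\<in>J. \<Prod>e\<in>b. p e"
  let ?r = "\<Sum>b\<in>J. (\<Prod>e\<in>b. p e) * ?P {X. U b (X - b)} + (\<Prod>e\<in>b. p e)\<^sup>2"
  have aE: "a \<subseteq> E" using insert by auto
  have pe: "0 \<le> p e" "p e \<le> 1" if "e \<in> a" for e using that aE assms(2) by auto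
  have q: "0 \<le> q" "q \<le> 1" using pe by (auto simp: q_def intro: prod_nonneg prod_le_1)
  note indep = prob_contains_and_rest[OF assms(1) aE assms(2)]
  have N'_eq: "N' = {X. \<forall>b\<in>J. b \<inter> a = {} \<longrightarrow> \<not> b \<subseteq> X - a}" by (auto simp: N'_def)
  have 1: "?P {X. a \<subseteq> X \<and> X \<in> N'} = q * ?P N'"
    using indep[where B = "\<lambda>Y. \<forall>b\<in>J. b \<inter> a = {} \<longrightarrow> \<not> b \<subseteq> Y"] by (simp add: N'_eq q_def)
  have 2: "?P {X. a \<subseteq> X \<and> X \<in> V} = q * ?P V"
    using indep[where B = "U a"] by (simp add: V_def q_def)
  \<comment> \<open>\<open>N\<close> and the event \<open>N'\<close>, which is independent of
    \<open>a\<close>, differ only inside \<open>V\<close>\<close>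
  have cover: "N' \<subseteq> N \<union> V" "N \<subseteq> N'"
  proof
    fix X assume X: "X \<in> N'"
    show "X \<in> N \<union> V"
    proof (rule ccontr)
      assume "X \<notin> N \<union> V"
      then obtain b where b: "b \<in> J" "b \<subseteq> X" "\<not> U a (X - a)" by (auto simp: N_def V_def)
      with X have "a \<inter> b \<noteq> {}" by (auto simp: N'_def)
      with b insert.prems(2)[of a b X] insert.hyps show False by auto
    qed
  qed (auto simp: N_def N'_def)
  have "?P N' \<le> ?P N + ?P V"
    using measure_pmf.finite_measure_mono[OF cover(1)] measure_Un_le[of N "measure_pmf (bernoulli_subset E p)" V]
    by (auto intro: order_trans)
  moreover have "?P N \<le> ?P N'" using cover by (intro measure_pmf.finite_measure_mono) auto
  moreover have "?P {X. a \<subseteq> X \<and> X \<in> N} \<le> q * ?P N'"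
    unfolding 1[symmetric] using cover by (intro measure_pmf.finite_measure_mono) auto
  moreover have "q * ?P N' \<le> ?P {X. a \<subseteq> X \<and> X \<in> N} + q * ?P V"
  proof -
    have "q * ?P N' \<le> ?P ({X. a \<subseteq> X \<and> X \<in> N} \<union> {X. a \<subseteq> X \<and> X \<in> V})"
      unfolding 1[symmetric] using cover by (intro measure_pmf.finite_measure_mono) auto
    also have "\<dots> \<le> ?P {X. a \<subseteq> X \<and> X \<in> N} + ?P {X. a \<subseteq> X \<and> X \<in> V}"
      by (intro measure_Un_le) auto
    finally show ?thesis using 2 by simp
  qed
  ultimately have "q * ?P N - q * ?P V \<le> ?P {X. a \<subseteq> X \<and> X \<in> N}"
      "?P {X. a \<subseteq> X \<and> X \<in> N} \<le> q * ?P N + q * ?P V"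
    using mult_left_mono[of "?P N" "?P N'" q] mult_left_mono[of "?P N'" "?P N + ?P V" q] q
    by (auto simp: distrib_left)
  hence 3: "\<bar>?P {X. a \<subseteq> X \<and> X \<in> N} - q * ?P N\<bar> \<le> q * ?P V" by auto
  have 4: "?P {X. \<forall>b\<in>insert a J. \<not> b \<subseteq> X} = ?P N - ?P {X. a \<subseteq> X \<and> X \<in> N}"
  proof -
    have "{X. \<forall>b\<in>insert a J. \<not> b \<subseteq> X} = N - {X. a \<subseteq> X \<and> X \<in> N}" by (auto simp: N_def)
    moreover have "?P (N - {X. a \<subseteq> X \<and> X \<in> N}) = ?P N - ?P {X. a \<subseteq> X \<and> X \<in> N}"
      by (rule measure_pmf.finite_measure_Diff) auto
    ultimately show ?thesis by simp
  qed
  have IH: "\<bar>?P N - exp (- ?s)\<bar> \<le> ?r"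
    unfolding N_def by (intro insert.IH insert.prems) auto
  have PN: "0 \<le> ?P N" "?P N \<le> 1" by auto
  have "\<bar>(1 - q) * ?P N - exp (- (q + ?s))\<bar> = \<bar>(1 - q - exp (- q)) * ?P N + exp (- q) * (?P N - exp (- ?s))\<bar>"
    by (simp add: algebra_simps exp_add[symmetric])
  also have "\<dots> \<le> \<bar>1 - q - exp (- q)\<bar> * ?P N + exp (- q) * \<bar>?P N - exp (- ?s)\<bar>"
    by (rule order_trans[OF abs_triangle_ineq]) (simp add: abs_mult)
  also have "\<dots> \<le> q\<^sup>2 * 1 + 1 * ?r"
    using one_minus_exp_bounds[OF q(1)] q PN IH
    by (intro add_mono mult_mono) (auto simp: abs_minus_commute)
  finally have "\<bar>?P {X. \<forall>b\<in>insert a J. \<not> b \<subseteq> X} - exp (- (q + ?s))\<bar> \<le> q * ?P V + q\<^sup>2 + ?r"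
    using 3 4 by (simp add: algebra_simps)
  thus ?case using insert.hyps by (simp add: q_def V_def)
qed

section \<open>Weighted sums over lists of vertices\<close>

definition lists_of :: "'a set \<Rightarrow> nat \<Rightarrow> 'a list set" where
  "lists_of V k = {vs. set vs \<subseteq> V \<and> length vs = k}"

lemma finite_lists_of: "finite V \<Longrightarrow> finite (lists_of V k)"
  unfolding lists_of_def by (rule finite_lists_length_eq)

lemma sum_lists_prod:
  fixes f :: "nat \<Rightarrow> 'a \<Rightarrow> real"
  assumes "finite V"
  shows "(\<Sum>vs\<in>lists_of V k. \<Prod>i<k. f i (vs ! i)) = (\<Prod>i<k. \<Sum>v\<in>V. f i v)"
proof (induction k arbitrary: f)
  case 0
  have "lists_of V 0 = {[]}" by (auto simp: lists_of_def)
  then show ?case by simp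
next
  case (Suc k)
  have eq: "lists_of V (Suc k) = (\<lambda>(x, xs). x # xs) ` (V \<times> lists_of V k)"
    by (auto simp: lists_of_def length_Suc_conv image_iff)
  have inj: "inj_on (\<lambda>(x, xs). x # xs) (V \<times> lists_of V k)" by (auto simp: inj_on_def)
  have "(\<Sum>vs\<in>lists_of V (Suc k). \<Prod>i<Suc k. f i (vs ! i)) =
    (\<Sum>(x, xs)\<in>V \<times> lists_of V k. f 0 x * (\<Prod>i<k. f (Suc i) (xs ! i)))"
    unfolding eq by (subst sum.reindex[OF inj]) (auto simp: prod.lessThan_Suc_shift case_prod_beta simp del: prod.lessThan_Suc intro!: sum.cong)
  also have "\<dots> = (\<Sum>x\<in>V. f 0 x) * (\<Sum>xs\<in>lists_of V k. \<Prod>i<k. f (Suc i) (xs ! i))"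
    by (simp add: sum_product sum.cartesian_product)
  also have "\<dots> = (\<Prod>i<Suc k. \<Sum>v\<in>V. f i v)"
    by (subst Suc.IH) (simp add: prod.lessThan_Suc_shift del: prod.lessThan_Suc)
  finally show ?case .
qed

lemma prod_if_eq:
  fixes a b :: real assumes "j < k"
  shows "(\<Prod>i<k. if i = j then a else b) = a * b ^ (k - 1)"
proof -
  have "{..<k} = insert j ({..<k} - {j})" using assms by auto
  hence "(\<Prod>i<k. if i = j then a else b) = (\<Prod>i\<in>insert j ({..<k} - {j}). if i = j then a else b)"
    by simp
  also have "\<dots> = a * (\<Prod>i\<in>{..<k} - {j}. if i = j then a else b)"
    by (subst prod.insert) auto
  also have "(\<Prod>i\<in>{..<k} - {j}. if i = j then a else b) = (\<Prod>i\<in>{..<k} - {j}. b)"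
    by (intro prod.cong) auto
  also have "\<dots> = b ^ (k - 1)" using assms by simp
  finally show ?thesis .
qed

lemma prod_if_eq2:
  fixes a b c :: real assumes "j < k" "l < k" "j \<noteq> l"
  shows "(\<Prod>i<k. if i = j then a else if i = l then b else c) = a * b * c ^ (k - 2)"
proof -
  have "{..<k} = insert j (insert l ({..<k} - {j, l}))" using assms by auto
  hence "(\<Prod>i<k. if i = j then a else if i = l then b else c) =
      (\<Prod>i\<in>insert j (insert l ({..<k} - {j, l})). if i = j then a else if i = l then b else c)"
    by simp
  also have "\<dots> = a * b * (\<Prod>i\<in>{..<k} - {j, l}. if i = j then a else if i = l then b else c)"
    using assms by (subst prod.insert; simp)+
  also have "(\<Prod>i\<in>{..<k} - {j, l}. if i = j then a else if i = l then b else c) = (\<Prod>i\<in>{..<k} - {j, l}. c)"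
    by (intro prod.cong) auto
  also have "\<dots> = c ^ (k - 2)" using assms by (simp add: card_Diff_subset numeral_2_eq_2)
  finally show ?thesis .
qed

lemma sum_lists_square_weights:
  fixes w :: "'a \<Rightarrow> real"
  assumes "finite V"
  shows "(\<Sum>vs\<in>lists_of V k. \<Prod>i<k. (w (vs ! i))\<^sup>2) = (\<Sum>v\<in>V. (w v)\<^sup>2) ^ k"
  using sum_lists_prod[OF assms, of "\<lambda>_ v. (w v)\<^sup>2" k] by simp

text \<open>One additional square turns a single factor \<open>\<Sum> w\<^sup>2\<close> into
  \<open>\<Sum> w\<^sup>4\<close>. All error terms are brought into this form or into that of
  the next lemma.\<close>

lemma sum_lists_one_fourth_power:
  fixes w :: "'a \<Rightarrow> real"
  assumes "finite V" "j < k"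
  shows "(\<Sum>vs\<in>lists_of V k. (\<Prod>i<k. (w (vs ! i))\<^sup>2) * (w (vs ! j))\<^sup>2) =
    (\<Sum>v\<in>V. w v ^ 4) * (\<Sum>v\<in>V. (w v)\<^sup>2) ^ (k - 1)"
proof -
  have "(\<Prod>i<k. (w (vs ! i))\<^sup>2) * (w (vs ! j))\<^sup>2 = (\<Prod>i<k. (if i = j then w (vs ! i) ^ 4 else (w (vs ! i))\<^sup>2))"
    for vs
  proof -
    have "(\<Prod>i<k. (w (vs ! i))\<^sup>2) * (w (vs ! j))\<^sup>2 =
      (\<Prod>i<k. (w (vs ! i))\<^sup>2) * (\<Prod>i<k. if i = j then (w (vs ! j))\<^sup>2 else 1)"
      using assms(2) prod_if_eq[OF assms(2), of "(w (vs ! j))\<^sup>2" 1] by simp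
    also have "\<dots> = (\<Prod>i<k. (if i = j then w (vs ! i) ^ 4 else (w (vs ! i))\<^sup>2))"
      unfolding prod.distrib[symmetric] by (intro prod.cong) (auto simp: power_add[symmetric])
    finally show ?thesis .
  qed
  hence "(\<Sum>vs\<in>lists_of V k. (\<Prod>i<k. (w (vs ! i))\<^sup>2) * (w (vs ! j))\<^sup>2) =
     (\<Sum>vs\<in>lists_of V k. (\<Prod>i<k. (\<lambda>i v. if i = j then w v ^ 4 else (w v)\<^sup>2) i (vs ! i)))"
    by simp
  also have "\<dots> = (\<Prod>i<k. \<Sum>v\<in>V. (\<lambda>i v. if i = j then w v ^ 4 else (w v)\<^sup>2) i v)"
    by (rule sum_lists_prod[OF assms(1)])
  also have "\<dots> = (\<Prod>i<k. if i = j then \<Sum>v\<in>V. w v ^ 4 else \<Sum>v\<in>V. (w v)\<^sup>2)"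
    by (intro prod.cong) auto
  finally show ?thesis using prod_if_eq[OF assms(2)] by simp
qed

text \<open>Two equal positions carry the same weight squared twice, so they contribute one
  \<open>\<Sum> w\<^sup>4\<close>.\<close>

lemma sum_lists_coincidence:
  fixes w :: "'a \<Rightarrow> real"
  assumes "finite V" "j < k" "l < k" "j \<noteq> l"
  shows "(\<Sum>vs\<in>{vs \<in> lists_of V k. vs ! j = vs ! l}. \<Prod>i<k. (w (vs ! i))\<^sup>2) =
    (\<Sum>v\<in>V. w v ^ 4) * (\<Sum>v\<in>V. (w v)\<^sup>2) ^ (k - 2)"
proof -
  \<comment> \<open>fixing the common value \<open>x\<close> of the two positions makes the
    summand a product over positions\<close>
  define f where "f x i v = (if i = j \<or> i = l then (if v = x then (w v)\<^sup>2 else 0) else (w v)\<^sup>2)" for x i v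
  have *: "(if vs ! j = vs ! l then \<Prod>i<k. (w (vs ! i))\<^sup>2 else 0) = (\<Sum>x\<in>V. \<Prod>i<k. f x i (vs ! i))"
    if "vs \<in> lists_of V k" for vs
  proof -
    have V: "vs ! j \<in> V" using that assms by (auto simp: lists_of_def)
    have "(\<Prod>i<k. f x i (vs ! i)) = (if x = vs ! j then (if vs ! j = vs ! l then \<Prod>i<k. (w (vs ! i))\<^sup>2 else 0) else 0)" for x
    proof (cases "x = vs ! j \<and> x = vs ! l")
      case True
      thus ?thesis by (auto simp: f_def intro!: prod.cong)
    next
      case False
      hence "f x j (vs ! j) = 0 \<or> f x l (vs ! l) = 0" unfolding f_def by metis
      hence "(\<Prod>i<k. f x i (vs ! i)) = 0" using assms(2,3) by (intro prod_zero) blast+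
      thus ?thesis using False by (simp only: if_False split: if_split) blast
    qed
    thus ?thesis using V assms(1) by (simp add: sum.delta)
  qed
  have "(\<Sum>vs\<in>{vs \<in> lists_of V k. vs ! j = vs ! l}. \<Prod>i<k. (w (vs ! i))\<^sup>2) =
      (\<Sum>vs\<in>lists_of V k. if vs ! j = vs ! l then \<Prod>i<k. (w (vs ! i))\<^sup>2 else 0)"
    by (rule sum.inter_filter[OF finite_lists_of[OF assms(1)]])
  also have "\<dots> = (\<Sum>vs\<in>lists_of V k. \<Sum>x\<in>V. \<Prod>i<k. f x i (vs ! i))"
    by (intro sum.cong refl *)
  also have "\<dots> = (\<Sum>x\<in>V. \<Prod>i<k. \<Sum>v\<in>V. f x i v)"
    by (subst sum.swap) (simp add: sum_lists_prod[OF assms(1)])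
  also have "\<dots> = (\<Sum>x\<in>V. \<Prod>i<k. if i = j then (w x)\<^sup>2 else if i = l then (w x)\<^sup>2 else \<Sum>v\<in>V. (w v)\<^sup>2)"
    by (intro sum.cong prod.cong) (auto simp: f_def sum.delta assms(1))
  also have "\<dots> = (\<Sum>x\<in>V. w x ^ 4 * (\<Sum>v\<in>V. (w v)\<^sup>2) ^ (k - 2))"
    unfolding prod_if_eq2[OF assms(2-4)] by (simp flip: power_add)
  finally show ?thesis by (simp add: sum_distrib_right)
qed

lemma sum_nondistinct_lists_le:
  fixes w :: "'a \<Rightarrow> real"
  assumes "finite V"
  shows "(\<Sum>vs\<in>{vs \<in> lists_of V k. \<not> distinct vs}. \<Prod>i<k. (w (vs ! i))\<^sup>2) \<le>
    (real k)\<^sup>2 * ((\<Sum>v\<in>V. w v ^ 4) * (\<Sum>v\<in>V. (w v)\<^sup>2) ^ (k - 2))"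
proof -
  let ?J = "{(j, l). j < k \<and> l < k \<and> j \<noteq> l}"
  let ?g = "\<lambda>vs. \<Prod>i<k. (w (vs ! i))\<^sup>2" and ?b = "(\<Sum>v\<in>V. w v ^ 4) * (\<Sum>v\<in>V. (w v)\<^sup>2) ^ (k - 2)"
  have J: "?J \<subseteq> {..<k} \<times> {..<k}" by auto
  hence fin: "finite ?J" by (rule finite_subset) auto
  have "card ?J \<le> k * k" using card_mono[OF _ J] by simp
  hence card: "real (card ?J) \<le> (real k)\<^sup>2" by (simp add: power2_eq_square flip: of_nat_mult)
  have "0 \<le> (\<Sum>v\<in>V. w v ^ 4)" "0 \<le> (\<Sum>v\<in>V. (w v)\<^sup>2)" by (auto intro!: sum_nonneg)
  hence b: "0 \<le> ?b" by simp
  have g: "0 \<le> ?g vs" for vs by (intro prod_nonneg) auto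
  have "(\<Sum>vs\<in>{vs \<in> lists_of V k. \<not> distinct vs}. ?g vs) =
    (\<Sum>vs\<in>lists_of V k. if \<not> distinct vs then ?g vs else 0)"
    by (rule sum.inter_filter[OF finite_lists_of[OF assms]])
  also have "\<dots> \<le> (\<Sum>vs\<in>lists_of V k. \<Sum>c\<in>?J. if vs ! fst c = vs ! snd c then ?g vs else 0)"
  proof (rule sum_mono)
    fix vs assume vs: "vs \<in> lists_of V k"
    have nn: "0 \<le> (if vs ! fst c = vs ! snd c then ?g vs else 0)" for c using g by simp
    show "(if \<not> distinct vs then ?g vs else 0) \<le> (\<Sum>c\<in>?J. if vs ! fst c = vs ! snd c then ?g vs else 0)"
    proof (cases "distinct vs")
      case True
      thus ?thesis using sum_nonneg[of ?J, OF nn] by simp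
    next
      case False
      then obtain c where c: "c \<in> ?J" "vs ! fst c = vs ! snd c"
        using vs by (auto simp: distinct_conv_nth lists_of_def)
      have "(if vs ! fst c = vs ! snd c then ?g vs else 0) \<le> (\<Sum>c\<in>?J. if vs ! fst c = vs ! snd c then ?g vs else 0)"
        using nn by (intro member_le_sum c(1) fin)
      thus ?thesis using False c(2) by simp
    qed
  qed
  also have "\<dots> = (\<Sum>c\<in>?J. \<Sum>vs\<in>{vs \<in> lists_of V k. vs ! fst c = vs ! snd c}. ?g vs)"
    by (subst sum.swap) (intro sum.cong refl sum.inter_filter[symmetric] finite_lists_of[OF assms])
  also have "\<dots> = (\<Sum>c\<in>?J. ?b)"
    by (intro sum.cong refl sum_lists_coincidence[OF assms]) auto
  also have "\<dots> \<le> (real k)\<^sup>2 * ?b" using mult_right_mono[OF card b] by simp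
  finally show ?thesis .
qed

definition cycles :: "'a set \<Rightarrow> nat set \<Rightarrow> 'a set set set" where
  "cycles V A = cycle_edges ` {vs. cycle_list vs \<and> set vs \<subseteq> V \<and> length vs \<in> A}"

text \<open>Summing over cycles is summing over lists, each list counted with the weight
  \<open>1 / (2 * k)\<close> because \<open>2 * k\<close> lists traverse the same cycle. A list
  without repetition is not longer than the number of vertices, so finitely many lengths remain
  even if \<open>A\<close> is infinite.\<close>

lemma sum_over_cycles:
  fixes f :: "'a set set \<Rightarrow> real"
  assumes "finite V"
  shows "(\<Sum>a\<in>cycles V A. f a) =
    (\<Sum>k\<in>A \<inter> {3..card V}. \<Sum>vs\<in>{vs \<in> lists_of V k. distinct vs}. f (cycle_edges vs) / (2 * real k))"
proof -
  let ?D = "{vs. cycle_list vs \<and> set vs \<subseteq> V \<and> length vs \<in> A}"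
  have len: "length vs \<le> card V" if "distinct vs" "set vs \<subseteq> V" for vs
    using card_mono[OF assms that(2)] distinct_card[OF that(1)] by simp
  have "?D \<subseteq> {vs. set vs \<subseteq> V \<and> length vs \<le> card V}" using len by (auto simp: cycle_list_def)
  hence fin: "finite ?D" by (rule finite_subset) (rule finite_lists_length_le[OF assms])
  have D: "?D = (\<Union>k\<in>A \<inter> {3..card V}. {vs \<in> lists_of V k. distinct vs})"
    using len by (auto simp: cycle_list_def lists_of_def)
  have "(\<Sum>vs\<in>?D. f (cycle_edges vs) / (2 * real (length vs))) =
    (\<Sum>a\<in>cycles V A. \<Sum>vs\<in>{vs \<in> ?D. cycle_edges vs = a}. f (cycle_edges vs) / (2 * real (length vs)))"
    unfolding cycles_def by (rule sum.image_gen[OF fin])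
  also have "\<dots> = (\<Sum>a\<in>cycles V A. f a)"
  proof (rule sum.cong[OF refl])
    fix a assume "a \<in> cycles V A"
    then obtain us where us: "us \<in> ?D" "a = cycle_edges us" by (auto simp: cycles_def)
    have inv: "length vs = length us \<and> set vs = set us" if "cycle_list vs" "cycle_edges vs = a" for vs
      using that us card_cycle_edges[of vs] card_cycle_edges[of us]
        Union_cycle_edges[of vs] Union_cycle_edges[of us] by auto
    have us': "set us \<subseteq> V" "length us \<in> A" using us(1) by simp_all
    have "vs \<in> ?D \<and> cycle_edges vs = a \<longleftrightarrow> cycle_list vs \<and> cycle_edges vs = cycle_edges us" for vs
      using inv[of vs] us' unfolding us(2) mem_Collect_eq by metis
    hence eq: "{vs \<in> ?D. cycle_edges vs = a} = {vs. cycle_list vs \<and> cycle_edges vs = cycle_edges us}"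
      by (rule Collect_cong)
    have "(\<Sum>vs\<in>{vs \<in> ?D. cycle_edges vs = a}. f (cycle_edges vs) / (2 * real (length vs))) =
      (\<Sum>vs\<in>{vs. cycle_list vs \<and> cycle_edges vs = cycle_edges us}. f a / (2 * real (length us)))"
      unfolding eq
    proof (intro sum.cong refl)
      fix vs assume "vs \<in> {vs. cycle_list vs \<and> cycle_edges vs = cycle_edges us}"
      hence vs: "cycle_list vs" "cycle_edges vs = a" unfolding us(2) by simp_all
      with inv[OF vs] show "f (cycle_edges vs) / (2 * real (length vs)) = f a / (2 * real (length us))"
        by simp
    qed
    also have "\<dots> = f a"
    proof -
      have "cycle_list us" "length us \<noteq> 0" using us(1) by (auto simp: cycle_list_def)
      thus ?thesis by (simp add: card_cycle_lists)
    qed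
    finally show "(\<Sum>vs\<in>{vs \<in> ?D. cycle_edges vs = a}. f (cycle_edges vs) / (2 * real (length vs))) = f a" .
  qed
  also have "(\<Sum>vs\<in>?D. f (cycle_edges vs) / (2 * real (length vs))) =
    (\<Sum>k\<in>A \<inter> {3..card V}. \<Sum>vs\<in>{vs \<in> lists_of V k. distinct vs}. f (cycle_edges vs) / (2 * real (length vs)))"
    unfolding D by (rule sum.UNION_disjoint) (auto simp: finite_lists_of[OF assms], auto simp: lists_of_def)
  also have "\<dots> = (\<Sum>k\<in>A \<inter> {3..card V}. \<Sum>vs\<in>{vs \<in> lists_of V k. distinct vs}. f (cycle_edges vs) / (2 * real k))"
    by (intro sum.cong) (auto simp: lists_of_def)
  finally show ?thesis by simp
qed

section \<open>The graph with fixed weights\<close>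

lemma bij_betw_cyclic_shift:
  fixes k :: nat
  shows "bij_betw (\<lambda>i. Suc i mod k) {..<k} {..<k}"
proof (cases "k = 0")
  case False
  have "inj_on (\<lambda>i. Suc i mod k) {..<k}"
    by (auto simp: inj_on_def mod_Suc split: if_splits)
  moreover have "(\<lambda>i. Suc i mod k) ` {..<k} \<subseteq> {..<k}" using False by auto
  ultimately show ?thesis
    using endo_inj_surj[of "{..<k}" "\<lambda>i. Suc i mod k"] by (simp add: bij_betw_def)
qed simp

text \<open>Bounds the effect of replacing the edge probability \<open>x / (x + L)\<close> by
  \<open>x / L\<close> along a cycle: with \<open>y = x / L\<close> the quotient of the two is
  \<open>1 / (1 + y)\<close>.\<close>

lemma prod_inverse_one_plus_ge:
  fixes y :: "'i \<Rightarrow> real"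
  assumes "finite I" "\<And>i. i \<in> I \<Longrightarrow> 0 \<le> y i"
  shows "1 - (\<Sum>i\<in>I. y i) \<le> (\<Prod>i\<in>I. 1 / (1 + y i)) \<and> (\<Prod>i\<in>I. 1 / (1 + y i)) \<le> 1 \<and> 0 \<le> (\<Prod>i\<in>I. 1 / (1 + y i))"
  using assms
proof (induction I rule: finite_induct)
  case empty
  then show ?case by simp
next
  case (insert i I)
  let ?P = "\<Prod>i\<in>I. 1 / (1 + y i)"
  have P: "1 - (\<Sum>i\<in>I. y i) \<le> ?P" "?P \<le> 1" "0 \<le> ?P" and y: "0 \<le> y i"
    using insert by auto
  have "1 - y i \<le> 1 / (1 + y i)" using y by (simp add: field_simps)
  hence "(1 - y i) * ?P \<le> 1 / (1 + y i) * ?P" using P by (intro mult_right_mono)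
  moreover have "y i * ?P \<le> y i * 1" using P y by (intro mult_left_mono)
  moreover have "1 / (1 + y i) * ?P \<le> 1 * 1" using P y by (intro mult_mono) auto
  moreover have "0 \<le> 1 / (1 + y i) * ?P" using P y by simp
  ultimately show ?case using P insert.hyps by (simp add: algebra_simps)
qed

lemma finite_possible_edges: "finite (possible_edges n)"
  unfolding possible_edges_def by (rule finite_subset[of _ "Pow {1..n}"]) auto

lemma grg_given_weights_eq:
  "grg_given_weights n w = bernoulli_subset (possible_edges n) (edge_prob n w)"
  by (simp add: grg_given_weights_def bernoulli_subset_def)

lemma cycle_edges_possible:
  assumes "cycle_list vs" "set vs \<subseteq> {1..n}"
  shows "cycle_edges vs \<subseteq> possible_edges n"
proof
  fix e assume "e \<in> cycle_edges vs"
  then obtain i where i: "i < length vs" "e = {vs ! i, vs ! (Suc i mod length vs)}"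
    by (auto simp: cycle_edges_def)
  have k: "3 \<le> length vs" "distinct vs" using assms by (auto simp: cycle_list_def)
  have lt: "Suc i mod length vs < length vs" using k(1) by (intro mod_less_divisor) linarith
  have "vs ! i \<noteq> vs ! (Suc i mod length vs)"
    using Suc_mod_neq[OF k(1) i(1)] nth_eq_iff_index_eq[OF k(2) i(1) lt] by metis
  thus "e \<in> possible_edges n"
    using assms(2) nth_mem[OF i(1)] nth_mem[OF lt] by (auto simp: i(2) possible_edges_def)
qed

lemma prod_consecutive:
  fixes a :: "nat \<Rightarrow> real"
  shows "(\<Prod>i<Suc m. a i * a (Suc i)) = a 0 * (\<Prod>i<m. (a (Suc i))\<^sup>2) * a (Suc m)"
proof -
  have "(\<Prod>i<Suc m. a i * a (Suc i)) = (\<Prod>i<Suc m. a i) * (\<Prod>i<Suc m. a (Suc i))"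
    by (rule prod.distrib)
  also have "(\<Prod>i<Suc m. a i) = a 0 * (\<Prod>i<m. a (Suc i))"
    by (rule prod.lessThan_Suc_shift)
  finally show ?thesis by (simp add: power2_eq_square prod.distrib)
qed

lemma summable_on_times_geometric:
  fixes q :: real
  assumes "0 \<le> q" "q < 1"
  shows "(\<lambda>k. real k * q ^ (k - 2)) summable_on UNIV"
proof -
  have "summable (\<lambda>k. real (Suc k) * q ^ k)"
    using geometric_deriv_sums[of q] assms by (auto simp: sums_iff)
  moreover have "summable (\<lambda>k. q ^ k)" using assms by (intro summable_geometric) auto
  ultimately have "summable (\<lambda>k. real (Suc k) * q ^ k + q ^ k)" by (rule summable_add)
  also have "(\<lambda>k. real (Suc k) * q ^ k + q ^ k) = (\<lambda>k. real (k + 2) * q ^ ((k + 2) - 2))"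
    by (auto simp: algebra_simps)
  finally have "summable (\<lambda>k. real k * q ^ (k - 2))"
    by (subst (asm) summable_iff_shift)
  thus ?thesis using assms by (intro norm_summable_imp_summable_on) simp
qed

text \<open>In every estimate below, cycles of length \<open>k\<close> contribute at most a
  multiple of \<open>k * q ^ (k - 2)\<close> to the error. The sum of these bounds over all
  \<open>k\<close> makes the estimates uniform in the set of lengths.\<close>

definition geom_moment :: "real \<Rightarrow> real" where
  "geom_moment q = (\<Sum>\<^sub>\<infinity>k. real k * q ^ (k - 2))"

lemma geom_moment_nonneg: "0 \<le> q \<Longrightarrow> 0 \<le> geom_moment q"
  unfolding geom_moment_def by (intro infsum_nonneg) auto

lemma sum_le_geom_moment:
  assumes "0 \<le> q" "q < 1" "finite F"
  shows "(\<Sum>k\<in>F. real k * q ^ (k - 2)) \<le> geom_moment q"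
  unfolding geom_moment_def
  by (rule finite_sum_le_infsum) (use assms summable_on_times_geometric[of q] in auto)

lemma infsum_diff_le_geom_moment:
  fixes f g :: "nat \<Rightarrow> real"
  assumes "0 \<le> q" "q < 1" "0 \<le> c" "f summable_on A" "g summable_on A"
    and le: "\<And>k. k \<in> A \<Longrightarrow> \<bar>f k - g k\<bar> \<le> real k * q ^ (k - 2) * c"
  shows "\<bar>(\<Sum>\<^sub>\<infinity>k\<in>A. f k) - (\<Sum>\<^sub>\<infinity>k\<in>A. g k)\<bar> \<le> geom_moment q * c"
proof -
  let ?h = "\<lambda>k. real k * q ^ (k - 2) * c"
  have h: "?h summable_on UNIV"
    by (intro summable_on_cmult_left summable_on_times_geometric assms)
  have hA: "?h summable_on A" by (rule summable_on_subset_banach[OF h]) simp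
  have d: "(\<lambda>k. f k - g k) summable_on A" using summable_on_add[OF assms(4), of "\<lambda>k. - g k"] assms(5) by (simp add: summable_on_uminus)
  have "(\<Sum>\<^sub>\<infinity>k\<in>A. f k) - (\<Sum>\<^sub>\<infinity>k\<in>A. g k) = (\<Sum>\<^sub>\<infinity>k\<in>A. f k - g k)"
    using infsum_add[OF assms(4), of "\<lambda>k. - g k"] assms(5) by (simp add: summable_on_uminus infsum_uminus)
  moreover have "(\<Sum>\<^sub>\<infinity>k\<in>A. f k - g k) \<le> (\<Sum>\<^sub>\<infinity>k\<in>A. ?h k)"
    by (intro infsum_mono d hA) (use le abs_le_D1 in blast)
  moreover have "(\<Sum>\<^sub>\<infinity>k\<in>A. - ?h k) \<le> (\<Sum>\<^sub>\<infinity>k\<in>A. f k - g k)"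
    by (intro infsum_mono d summable_on_uminus[THEN iffD2] hA) (use le in \<open>force simp: abs_le_iff\<close>)
  moreover have "(\<Sum>\<^sub>\<infinity>k\<in>A. ?h k) \<le> (\<Sum>\<^sub>\<infinity>k. ?h k)"
    by (rule infsum_mono_neutral[OF hA h]) (use assms in auto)
  moreover have "(\<Sum>\<^sub>\<infinity>k. ?h k) = geom_moment q * c"
    unfolding geom_moment_def by (rule infsum_cmult_left') 
  ultimately show ?thesis by (simp add: infsum_uminus abs_le_iff)
qed

lemma summable_on_rate:
  fixes r :: real assumes "0 \<le> r" "r < 1"
  shows "(\<lambda>k. r ^ k / (2 * real k)) summable_on A"
proof -
  have "summable (\<lambda>k. r ^ k)" using assms by (intro summable_geometric) auto
  hence "(\<lambda>k. r ^ k) summable_on UNIV"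
    using assms by (intro norm_summable_imp_summable_on) simp
  hence "(\<lambda>k. r ^ k / (2 * real k)) summable_on UNIV"
  proof (rule summable_on_comparison_test)
    fix k :: nat
    show "r ^ k / (2 * real k) \<le> r ^ k"
    proof (cases "k = 0")
      case False
      hence "1 \<le> 2 * real k" by simp
      thus ?thesis using assms mult_left_mono[of 1 "2 * real k" "r ^ k"] False
        by (simp add: divide_le_eq)
    qed simp
  qed (use assms in auto)
  thus ?thesis by (rule summable_on_subset_banach) simp
qed

lemma exp_minus_lipschitz:
  fixes x y :: real
  assumes "0 \<le> x" "0 \<le> y"
  shows "\<bar>exp (- x) - exp (- y)\<bar> \<le> \<bar>x - y\<bar>"
proof -
  have *: "exp (- x) - exp (- y) \<le> y - x" if "0 \<le> x" "x \<le> y" for x y :: real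
  proof -
    have "exp (- x) - exp (- y) = exp (- x) * (1 - exp (- (y - x)))"
      by (simp add: algebra_simps flip: exp_add)
    also have "\<dots> \<le> 1 * (y - x)"
      proof (intro mult_mono)
      have "1 + - (y - x) \<le> exp (- (y - x))" by (rule exp_ge_add_one_self)
      thus "1 - exp (- (y - x)) \<le> y - x" by linarith
    qed (use that in auto)
    finally show ?thesis by simp
  qed
  have "exp (- x) \<le> exp (- y) \<longleftrightarrow> y \<le> x" by simp
  with *[of x y] *[of y x] assms show ?thesis by (cases "x \<le> y") (auto simp: abs_if)
qed

text \<open>The weights are now fixed. \<open>ratio\<close> estimates \<open>E[W\<^sup>2] /
  E[W]\<close>, and \<open>fourth\<close> is the quantity of order \<open>1 / n\<close> that
  bounds every conditional error.\<close>

locale positive_weights =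
  fixes n :: nat and w :: "nat \<Rightarrow> real"
  assumes n_pos: "0 < n" and w_pos: "\<And>i. i \<in> {1..n} \<Longrightarrow> 0 < w i"
begin

definition total :: real where "total = (\<Sum>i=1..n. w i)"
definition ratio :: real where "ratio = (\<Sum>i=1..n. (w i)\<^sup>2) / total"
definition fourth :: real where "fourth = (\<Sum>i=1..n. w i ^ 4) / total\<^sup>2"

definition list_weight :: "nat list \<Rightarrow> real" where
  "list_weight vs = (\<Prod>i<length vs. (w (vs ! i))\<^sup>2 / total)"
definition list_square_sum :: "nat list \<Rightarrow> real" where
  "list_square_sum vs = (\<Sum>i<length vs. (w (vs ! i))\<^sup>2 / total)"

lemma total_pos: "0 < total"
  unfolding total_def using n_pos w_pos by (intro sum_pos) auto

lemma ratio_nonneg: "0 \<le> ratio" and fourth_nonneg: "0 \<le> fourth"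
  unfolding ratio_def fourth_def using total_pos by (auto intro!: divide_nonneg_nonneg sum_nonneg)

lemma list_weight_nonneg: "0 \<le> list_weight vs" and list_square_sum_nonneg: "0 \<le> list_square_sum vs"
  unfolding list_weight_def list_square_sum_def using total_pos by (auto intro!: prod_nonneg sum_nonneg)

lemma edge_prob_doubleton:
  "u \<noteq> v \<Longrightarrow> edge_prob n w {u, v} = w u * w v / (w u * w v + total)"
  by (simp add: edge_prob_def total_def)

lemma edge_prob_bounds:
  assumes "e \<in> possible_edges n"
  shows "0 \<le> edge_prob n w e \<and> edge_prob n w e \<le> 1"
proof -
  have "0 \<le> (\<Prod>i\<in>e. w i)" using assms w_pos
    by (intro prod_nonneg) (auto simp: possible_edges_def less_imp_le)
  thus ?thesis using total_pos by (simp only: edge_prob_def flip: total_def) (simp add: divide_le_eq)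
qed

text \<open>The idealised expected number of cycles of length \<open>k\<close> is therefore
  \<open>ratio ^ k / (2 * k)\<close>: vertices may repeat, and edge probabilities are replaced
  by \<open>w i * w j / total\<close>.\<close>

lemma sum_list_weight: "(\<Sum>vs\<in>lists_of {1..n} k. list_weight vs) = ratio ^ k"
proof -
  have "(\<Sum>vs\<in>lists_of {1..n} k. list_weight vs) =
    (\<Sum>vs\<in>lists_of {1..n} k. (\<Prod>i<k. (w (vs ! i))\<^sup>2) / total ^ k)"
    by (intro sum.cong) (auto simp: list_weight_def lists_of_def prod_dividef)
  thus ?thesis
    by (simp add: sum_lists_square_weights ratio_def power_divide flip: sum_divide_distrib)
qed

lemma sum_list_weight_square_sum:
  assumes "0 < k"
  shows "(\<Sum>vs\<in>lists_of {1..n} k. list_weight vs * list_square_sum vs) = real k * (ratio ^ (k - 1) * fourth)"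
proof -
  have "(\<Sum>vs\<in>lists_of {1..n} k. list_weight vs * list_square_sum vs) =
    (\<Sum>vs\<in>lists_of {1..n} k. \<Sum>j<k. (\<Prod>i<k. (w (vs ! i))\<^sup>2) * (w (vs ! j))\<^sup>2 / total ^ Suc k)"
    by (intro sum.cong refl)
      (auto simp: list_weight_def list_square_sum_def lists_of_def prod_dividef sum_distrib_left sum_divide_distrib mult.commute)
  also have "\<dots> = (\<Sum>j<k. (\<Sum>vs\<in>lists_of {1..n} k. (\<Prod>i<k. (w (vs ! i))\<^sup>2) * (w (vs ! j))\<^sup>2) / total ^ Suc k)"
    by (subst sum.swap) (simp add: sum_divide_distrib)
  also have "\<dots> = (\<Sum>j<k. (\<Sum>i=1..n. w i ^ 4) * (\<Sum>i=1..n. (w i)\<^sup>2) ^ (k - 1) / total ^ Suc k)"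
    by (intro sum.cong refl) (simp add: sum_lists_one_fourth_power)
  also have "\<dots> = real k * (ratio ^ (k - 1) * fourth)"
    using assms by (cases k) (simp_all add: ratio_def fourth_def power_divide power2_eq_square mult_ac)
  finally show ?thesis .
qed

lemma sum_list_weight_nondistinct:
  assumes "2 \<le> k"
  shows "(\<Sum>vs\<in>{vs \<in> lists_of {1..n} k. \<not> distinct vs}. list_weight vs) \<le> (real k)\<^sup>2 * (ratio ^ (k - 2) * fourth)"
proof -
  have "(\<Sum>vs\<in>{vs \<in> lists_of {1..n} k. \<not> distinct vs}. list_weight vs) =
    (\<Sum>vs\<in>{vs \<in> lists_of {1..n} k. \<not> distinct vs}. (\<Prod>i<k. (w (vs ! i))\<^sup>2) / total ^ k)"
    by (intro sum.cong) (auto simp: list_weight_def lists_of_def prod_dividef)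
  also have "\<dots> = (\<Sum>vs\<in>{vs \<in> lists_of {1..n} k. \<not> distinct vs}. \<Prod>i<k. (w (vs ! i))\<^sup>2) / total ^ k"
    by (simp add: sum_divide_distrib)
  also have "\<dots> \<le> (real k)\<^sup>2 * ((\<Sum>i=1..n. w i ^ 4) * (\<Sum>i=1..n. (w i)\<^sup>2) ^ (k - 2)) / total ^ k"
    using total_pos by (intro divide_right_mono sum_nondistinct_lists_le) auto
  also have "total ^ k = total ^ (k - 2) * total\<^sup>2"
    by (simp only: power_add[symmetric] le_add_diff_inverse2[OF assms])
  finally show ?thesis by (simp add: ratio_def fourth_def power_divide mult.commute)
qed

lemma cycle_prob_eq:
  assumes "cycle_list vs"
  shows "(\<Prod>e\<in>cycle_edges vs. edge_prob n w e) =
    (\<Prod>i<length vs. w (vs ! i) * w (vs ! (Suc i mod length vs)) /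
      (w (vs ! i) * w (vs ! (Suc i mod length vs)) + total))"
proof -
  have k: "3 \<le> length vs" "distinct vs" using assms by (auto simp: cycle_list_def)
  have "(\<Prod>e\<in>cycle_edges vs. edge_prob n w e) =
    (\<Prod>i<length vs. edge_prob n w {vs ! i, vs ! (Suc i mod length vs)})"
    unfolding cycle_edges_def by (subst prod.reindex[OF inj_on_cycle_edge[OF assms]]) simp
  also have "\<dots> = (\<Prod>i<length vs. w (vs ! i) * w (vs ! (Suc i mod length vs)) /
      (w (vs ! i) * w (vs ! (Suc i mod length vs)) + total))"
  proof (intro prod.cong refl edge_prob_doubleton)
    fix i assume i: "i \<in> {..<length vs}"
    have lt: "Suc i mod length vs < length vs" using k(1) by (intro mod_less_divisor) linarith
    show "vs ! i \<noteq> vs ! (Suc i mod length vs)"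
      using Suc_mod_neq[OF k(1), of i] nth_eq_iff_index_eq[OF k(2) _ lt, of i] i by auto
  qed
  finally show ?thesis .
qed

text \<open>Each vertex of a cycle lies on two of its edges, so the product of the terms
  \<open>w i * w j / total\<close> over the edges is \<open>list_weight\<close>. The sum of
  these terms is at most \<open>list_square_sum\<close>, because \<open>2 * x * y \<le>
  x\<^sup>2 + y\<^sup>2\<close> and again every vertex is counted twice.\<close>

lemma cycle_prob_bounds:
  assumes c: "cycle_list vs" and V: "set vs \<subseteq> {1..n}"
  defines "P \<equiv> \<Prod>e\<in>cycle_edges vs. edge_prob n w e"
  shows "0 \<le> P" "P \<le> list_weight vs" "list_weight vs - P \<le> list_weight vs * list_square_sum vs"
    "P \<le> list_square_sum vs"
proof -
  define k where "k = length vs"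
  have k: "0 < k" using c by (auto simp: k_def cycle_list_def)
  define b where "b i = w (vs ! i)" for i
  define y where "y i = b i * b (Suc i mod k) / total" for i
  note L = total_pos
  have b: "0 < b i" if "i < k" for i using that V w_pos by (auto simp: b_def k_def subset_iff)
  have lt: "Suc i mod k < k" for i using k by simp
  have y: "0 < y i" if "i < k" for i using b[OF that] b[OF lt] L by (simp add: y_def)
  have P: "P = (\<Prod>i<k. y i * (1 / (1 + y i)))"
    unfolding P_def cycle_prob_eq[OF c] k_def[symmetric]
    by (intro prod.cong refl) (use L in \<open>simp add: y_def b_def field_simps\<close>)
  have M: "list_weight vs = (\<Prod>i<k. y i)"
  proof -
    have "(\<Prod>i<k. b (Suc i mod k)) = (\<Prod>i<k. b i)"
      by (rule prod.reindex_bij_betw[OF bij_betw_cyclic_shift])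
    thus ?thesis unfolding list_weight_def y_def k_def[symmetric] b_def[symmetric]
      by (simp add: prod_dividef prod.distrib power2_eq_square)
  qed
  have y_le: "y i \<le> ((b i)\<^sup>2 + (b (Suc i mod k))\<^sup>2) / (2 * total)" for i
  proof -
    have "2 * (b i * b (Suc i mod k)) \<le> (b i)\<^sup>2 + (b (Suc i mod k))\<^sup>2"
      using sum_squares_bound[of "b i" "b (Suc i mod k)"] by simp
    thus ?thesis using L by (simp add: y_def field_simps)
  qed
  have sum_y: "(\<Sum>i<k. y i) \<le> list_square_sum vs"
  proof -
    have "(\<Sum>i<k. y i) \<le> (\<Sum>i<k. ((b i)\<^sup>2 + (b (Suc i mod k))\<^sup>2) / (2 * total))"
      by (intro sum_mono y_le)
    also have "\<dots> = ((\<Sum>i<k. (b i)\<^sup>2) + (\<Sum>i<k. (b (Suc i mod k))\<^sup>2)) / (2 * total)"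
      by (simp add: sum.distrib flip: sum_divide_distrib)
    also have "(\<Sum>i<k. (b (Suc i mod k))\<^sup>2) = (\<Sum>i<k. (b i)\<^sup>2)"
      by (rule sum.reindex_bij_betw[OF bij_betw_cyclic_shift])
    finally show ?thesis
      by (simp add: list_square_sum_def b_def k_def flip: sum_divide_distrib)
  qed
  have R: "1 - (\<Sum>i<k. y i) \<le> (\<Prod>i<k. 1 / (1 + y i))" "(\<Prod>i<k. 1 / (1 + y i)) \<le> 1" "0 \<le> (\<Prod>i<k. 1 / (1 + y i))"
    using prod_inverse_one_plus_ge[of "{..<k}" y] y by (auto simp: less_imp_le)
  have MR: "P = list_weight vs * (\<Prod>i<k. 1 / (1 + y i))"
    unfolding M P by (rule prod.distrib)
  note M0 = list_weight_nonneg[of vs]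
  show "0 \<le> P" unfolding MR using R M0 by simp
  show "P \<le> list_weight vs" unfolding MR using mult_left_mono[OF R(2) M0] by simp
  have "list_weight vs - P = list_weight vs * (1 - (\<Prod>i<k. 1 / (1 + y i)))"
    unfolding MR by (simp add: algebra_simps)
  also have "\<dots> \<le> list_weight vs * list_square_sum vs"
    using R(1) sum_y M0 by (intro mult_left_mono) auto
  finally show "list_weight vs - P \<le> list_weight vs * list_square_sum vs" .
  have fac: "0 \<le> y i * (1 / (1 + y i)) \<and> y i * (1 / (1 + y i)) \<le> 1" if "i < k" for i
    using y[OF that] by simp
  have "P = y 0 * (1 / (1 + y 0)) * (\<Prod>i\<in>{..<k} - {0}. y i * (1 / (1 + y i)))"
    unfolding P using k by (subst prod.remove[of _ 0]) auto
  also have "\<dots> \<le> y 0 * (1 / (1 + y 0)) * 1"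
    using fac k by (intro mult_left_mono prod_le_1) auto
  also have "\<dots> \<le> y 0" using y[OF k] by (simp add: field_simps)
  also have "\<dots> \<le> (\<Sum>i<k. y i)" using k y by (intro member_le_sum) (auto simp: less_imp_le)
  also have "\<dots> \<le> list_square_sum vs" by (rule sum_y)
  finally show "P \<le> list_square_sum vs" .
qed

text \<open>\<open>ear a (X - a)\<close> says that \<open>X\<close> contains a path outside
  \<open>a\<close> that joins two vertices of \<open>a\<close>; it plays the role of the event
  \<open>U a\<close> in the Poisson approximation.\<close>

definition ear :: "nat set set \<Rightarrow> nat set set \<Rightarrow> bool" where
  "ear a Y \<longleftrightarrow> (\<exists>p. 2 \<le> length p \<and> distinct p \<and> set p \<subseteq> {1..n} \<and> p ! 0 \<in> \<Union> a \<and>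
     p ! (length p - 1) \<in> \<Union> a \<and> path_edges p \<subseteq> Y)"

lemma path_prob_le:
  assumes p: "distinct p" "set p \<subseteq> {1..n}" "length p = Suc (Suc m)"
  shows "measure_pmf.prob (grg_given_weights n w) {X. path_edges p \<subseteq> X} \<le>
    w (p ! 0) * (\<Prod>i<m. (w (p ! Suc i))\<^sup>2) * w (p ! Suc m) / total ^ Suc m"
proof -
  have inj: "inj_on (\<lambda>i. {p ! i, p ! Suc i}) {..<Suc m}"
    using p by (auto simp: inj_on_def doubleton_eq_iff nth_eq_iff_index_eq)
  have ne: "p ! i \<noteq> p ! Suc i" if "i < Suc m" for i
    using that p by (simp add: nth_eq_iff_index_eq)
  have V: "p ! i \<in> {1..n}" if "i < Suc (Suc m)" for i
    using that p(2,3) nth_mem[of i p] by (metis subsetD)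
  have pe: "path_edges p = (\<lambda>i. {p ! i, p ! Suc i}) ` {..<Suc m}"
    using p by (simp add: path_edges_def)
  have sub: "path_edges p \<subseteq> possible_edges n"
  proof
    fix e assume "e \<in> path_edges p"
    then obtain i where i: "i < Suc m" "e = {p ! i, p ! Suc i}" unfolding pe by blast
    thus "e \<in> possible_edges n"
      using V[of i] V[of "Suc i"] ne[of i] unfolding possible_edges_def mem_Collect_eq i(2) by simp
  qed
  have "measure_pmf.prob (grg_given_weights n w) {X. path_edges p \<subseteq> X} =
    (\<Prod>i<Suc m. edge_prob n w {p ! i, p ! Suc i})"
    unfolding grg_given_weights_eq
    by (subst prob_contains[OF finite_possible_edges sub edge_prob_bounds])
      (simp_all only: pe prod.reindex[OF inj] o_def)
  also have "\<dots> \<le> (\<Prod>i<Suc m. w (p ! i) * w (p ! Suc i) / total)"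
  proof (rule prod_mono, rule conjI)
    fix i assume i: "i \<in> {..<Suc m}"
    have pos: "0 < w (p ! i) * w (p ! Suc i)" using i V[of i] V[of "Suc i"] w_pos by simp
    show "0 \<le> edge_prob n w {p ! i, p ! Suc i}"
      using edge_prob_bounds sub i pe by blast
    show "edge_prob n w {p ! i, p ! Suc i} \<le> w (p ! i) * w (p ! Suc i) / total"
      using i ne[of i] pos total_pos by (auto simp: edge_prob_doubleton intro!: divide_left_mono)
  qed
  also have "\<dots> = (\<Prod>i<Suc m. w (p ! i) * w (p ! Suc i)) / total ^ Suc m"
    by (simp only: prod_dividef prod_constant card_lessThan)
  finally show ?thesis by (simp only: prod_consecutive[of "\<lambda>i. w (p ! i)" m])
qed

lemma sum_path_weights:
  assumes "S \<subseteq> {1..n}"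
  shows "(\<Sum>p\<in>{p \<in> lists_of {1..n} (Suc (Suc m)). p ! 0 \<in> S \<and> p ! Suc m \<in> S}.
      w (p ! 0) * (\<Prod>i<m. (w (p ! Suc i))\<^sup>2) * w (p ! Suc m) / total ^ Suc m) =
    (\<Sum>v\<in>S. w v)\<^sup>2 / total * ratio ^ m"
proof -
  define f where "f i v = (if i = 0 \<or> i = Suc m then (if v \<in> S then w v else 0) else (w v)\<^sup>2)" for i v
  have split: "(\<Prod>i<Suc (Suc m). g i) = g 0 * (\<Prod>i<m. g (Suc i)) * g (Suc m)" for g :: "nat \<Rightarrow> real"
    by (subst prod.lessThan_Suc_shift) (simp add: mult.assoc)
  have "(\<Sum>p\<in>{p \<in> lists_of {1..n} (Suc (Suc m)). p ! 0 \<in> S \<and> p ! Suc m \<in> S}.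
      w (p ! 0) * (\<Prod>i<m. (w (p ! Suc i))\<^sup>2) * w (p ! Suc m) / total ^ Suc m) =
    (\<Sum>p\<in>lists_of {1..n} (Suc (Suc m)). if p ! 0 \<in> S \<and> p ! Suc m \<in> S then
      w (p ! 0) * (\<Prod>i<m. (w (p ! Suc i))\<^sup>2) * w (p ! Suc m) / total ^ Suc m else 0)"
    by (rule sum.inter_filter) (simp add: finite_lists_of)
  also have "\<dots> = (\<Sum>p\<in>lists_of {1..n} (Suc (Suc m)). (\<Prod>i<Suc (Suc m). f i (p ! i)) / total ^ Suc m)"
  proof (intro sum.cong refl)
    fix p
    have "(\<Prod>i<m. f (Suc i) (p ! Suc i)) = (\<Prod>i<m. (w (p ! Suc i))\<^sup>2)"
      by (intro prod.cong) (auto simp: f_def)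
    thus "(if p ! 0 \<in> S \<and> p ! Suc m \<in> S then
      w (p ! 0) * (\<Prod>i<m. (w (p ! Suc i))\<^sup>2) * w (p ! Suc m) / total ^ Suc m else 0) =
      (\<Prod>i<Suc (Suc m). f i (p ! i)) / total ^ Suc m"
      unfolding split by (simp add: f_def)
  qed
  also have "\<dots> = (\<Sum>p\<in>lists_of {1..n} (Suc (Suc m)). \<Prod>i<Suc (Suc m). f i (p ! i)) / total ^ Suc m"
    by (rule sum_divide_distrib[symmetric])
  also have "\<dots> = (\<Prod>i<Suc (Suc m). \<Sum>v=1..n. f i v) / total ^ Suc m"
    by (subst sum_lists_prod) simp_all
  also have "(\<Prod>i<Suc (Suc m). \<Sum>v=1..n. f i v) = (\<Sum>v\<in>S. w v) * (\<Sum>v=1..n. (w v)\<^sup>2) ^ m * (\<Sum>v\<in>S. w v)"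
  proof -
    have "(\<Sum>v=1..n. if v \<in> S then w v else 0) = (\<Sum>v\<in>{1..n} \<inter> S. w v)"
      by (rule sum.inter_restrict[symmetric]) simp
    also have "{1..n} \<inter> S = S" using assms by auto
    finally have ends: "(\<Sum>v=1..n. f 0 v) = (\<Sum>v\<in>S. w v)" "(\<Sum>v=1..n. f (Suc m) v) = (\<Sum>v\<in>S. w v)"
      by (simp_all add: f_def)
    have inner: "(\<Prod>i<m. \<Sum>v=1..n. f (Suc i) v) = (\<Sum>v=1..n. (w v)\<^sup>2) ^ m"
      by (simp add: f_def)
    show ?thesis unfolding split ends inner ..
  qed
  finally show ?thesis using total_pos by (simp add: ratio_def power_divide power2_eq_square)
qed

text \<open>A union bound over all paths. The two ends contribute one weight each and every
  inner vertex contributes \<open>ratio\<close>, so the sum over the number \<open>m\<close> of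
  inner vertices is geometric.\<close>

lemma ear_prob_le:
  assumes a: "\<Union> a \<subseteq> {1..n}" and q: "ratio \<le> q" "q < 1"
  shows "measure_pmf.prob (grg_given_weights n w) {X. ear a (X - a)} \<le> (\<Sum>v\<in>\<Union> a. w v)\<^sup>2 / total / (1 - q)"
proof -
  let ?P = "measure_pmf.prob (grg_given_weights n w)"
  let ?S = "\<Union> a"
  define Q where "Q m = {p \<in> lists_of {1..n} (Suc (Suc m)). distinct p \<and> p ! 0 \<in> ?S \<and> p ! Suc m \<in> ?S}" for m
  let ?b = "\<lambda>m p. w (p ! 0) * (\<Prod>i<m. (w (p ! Suc i))\<^sup>2) * w (p ! Suc m) / total ^ Suc m"
  let ?R = "\<lambda>m. {p \<in> lists_of {1..n} (Suc (Suc m)). p ! 0 \<in> ?S \<and> p ! Suc m \<in> ?S}"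
  have fin: "finite (Q m)" "finite (?R m)" for m by (simp_all add: Q_def finite_lists_of)
  have b_nonneg: "0 \<le> ?b m p" if "p \<in> ?R m" for m p
  proof -
    have "p ! i \<in> {1..n}" if "i < Suc (Suc m)" for i
    proof -
      have "set p \<subseteq> {1..n}" "length p = Suc (Suc m)" using \<open>p \<in> ?R m\<close> by (simp_all add: lists_of_def)
      thus ?thesis using that nth_mem[of i p] by (metis subsetD)
    qed
    from this[of 0] this[of "Suc m"] have "0 < w (p ! 0)" "0 < w (p ! Suc m)" using w_pos by auto
    thus ?thesis using total_pos
      by (intro divide_nonneg_nonneg mult_nonneg_nonneg prod_nonneg) auto
  qed
  have "{X. ear a (X - a)} \<subseteq> (\<Union>m<n. \<Union>p\<in>Q m. {X. path_edges p \<subseteq> X})"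
  proof
    fix X assume "X \<in> {X. ear a (X - a)}"
    then obtain p where p: "2 \<le> length p" "distinct p" "set p \<subseteq> {1..n}" "p ! 0 \<in> ?S"
        "p ! (length p - 1) \<in> ?S" "path_edges p \<subseteq> X - a"
      by (auto simp: ear_def)
    have "length p \<le> n" using card_mono[OF _ p(3)] distinct_card[OF p(2)] by simp
    moreover obtain m where m: "length p = Suc (Suc m)"
      using p(1) by (metis Suc_le_D numeral_2_eq_2 Suc_le_mono)
    ultimately have "m < n" "p \<in> Q m" using p by (auto simp: Q_def lists_of_def)
    with p(6) show "X \<in> (\<Union>m<n. \<Union>p\<in>Q m. {X. path_edges p \<subseteq> X})" by blast
  qed
  hence "?P {X. ear a (X - a)} \<le> ?P (\<Union>m<n. \<Union>p\<in>Q m. {X. path_edges p \<subseteq> X})"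
    by (intro measure_pmf.finite_measure_mono) auto
  also have "\<dots> \<le> (\<Sum>m<n. ?P (\<Union>p\<in>Q m. {X. path_edges p \<subseteq> X}))"
    by (intro measure_pmf.finite_measure_subadditive_finite) auto
  also have "\<dots> \<le> (\<Sum>m<n. \<Sum>p\<in>Q m. ?P {X. path_edges p \<subseteq> X})"
    by (intro sum_mono measure_pmf.finite_measure_subadditive_finite fin) auto
  also have "\<dots> \<le> (\<Sum>m<n. \<Sum>p\<in>Q m. ?b m p)"
    by (intro sum_mono path_prob_le) (auto simp: Q_def lists_of_def)
  also have "\<dots> \<le> (\<Sum>m<n. \<Sum>p\<in>?R m. ?b m p)"
    by (intro sum_mono sum_mono2 fin b_nonneg) (auto simp: Q_def)
  also have "\<dots> = (\<Sum>m<n. (\<Sum>v\<in>?S. w v)\<^sup>2 / total * ratio ^ m)"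
    by (intro sum.cong refl sum_path_weights a)
  also have "\<dots> = (\<Sum>v\<in>?S. w v)\<^sup>2 / total * (\<Sum>m<n. ratio ^ m)"
    by (rule sum_distrib_left[symmetric])
  also have "\<dots> \<le> (\<Sum>v\<in>?S. w v)\<^sup>2 / total * (1 / (1 - q))"
  proof (intro mult_left_mono)
    have "(\<Sum>m<n. ratio ^ m) \<le> (\<Sum>m. ratio ^ m)"
      using ratio_nonneg q by (intro sum_le_suminf summable_geometric) auto
    also have "\<dots> = 1 / (1 - ratio)" using ratio_nonneg q by (intro suminf_geometric) auto
    also have "\<dots> \<le> 1 / (1 - q)" using q by (intro divide_left_mono) auto
    finally show "(\<Sum>m<n. ratio ^ m) \<le> 1 / (1 - q)" .
  qed (use total_pos in auto)
  finally show ?thesis by simp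
qed

text \<open>Cauchy-Schwarz trades the product of the two end weights of an ear for a single
  additional square, so that fourth powers of the weights suffice.\<close>

lemma vertex_sum_square_le:
  assumes "cycle_list vs"
  shows "(\<Sum>v\<in>\<Union> (cycle_edges vs). w v)\<^sup>2 / total \<le> real (length vs) * list_square_sum vs"
proof -
  have d: "distinct vs" using assms by (simp add: cycle_list_def)
  have "(\<Sum>v\<in>\<Union> (cycle_edges vs). w v) = (\<Sum>i<length vs. w (vs ! i))"
    unfolding Union_cycle_edges
    by (rule sum.reindex_bij_betw[symmetric, OF bij_betw_nth[OF d]]) auto
  moreover have "(\<Sum>i<length vs. w (vs ! i))\<^sup>2 \<le> real (length vs) * (\<Sum>i<length vs. (w (vs ! i))\<^sup>2)"
    using sum_squared_le_sum_of_squares[of "\<lambda>i. w (vs ! i)" "{..<length vs}"] by (simp add: mult.commute)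
  ultimately show ?thesis using total_pos
    by (simp add: list_square_sum_def divide_right_mono flip: sum_divide_distrib)
qed

text \<open>The two idealisations behind \<open>ratio ^ k\<close> both overestimate: the
  repeated vertices cost \<open>k\<^sup>2 * ratio ^ (k - 2) * fourth\<close>, the denominators
  cost \<open>k * ratio ^ (k - 1) * fourth\<close>. For \<open>k > n\<close> all lists have
  repetitions, so lengths beyond the number of vertices are covered too.\<close>

lemma cycle_rate_error:
  assumes k: "3 \<le> k" and r: "ratio < 1"
  defines "m \<equiv> (\<Sum>vs\<in>{vs \<in> lists_of {1..n} k. distinct vs}. \<Prod>e\<in>cycle_edges vs. edge_prob n w e)"
  shows "\<bar>ratio ^ k / (2 * real k) - m / (2 * real k)\<bar> \<le> real k * ratio ^ (k - 2) * fourth"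
proof -
  let ?L = "lists_of {1..n} k"
  let ?D = "{vs \<in> ?L. distinct vs}" and ?N = "{vs \<in> ?L. \<not> distinct vs}"
  let ?P = "\<lambda>vs. \<Prod>e\<in>cycle_edges vs. edge_prob n w e"
  have fin: "finite ?L" by (simp add: finite_lists_of)
  have D: "cycle_list vs" "set vs \<subseteq> {1..n}" if "vs \<in> ?D" for vs
    using that k by (auto simp: lists_of_def cycle_list_def)
  have L: "?L = ?D \<union> ?N" by auto
  have "ratio ^ k = sum list_weight (?D \<union> ?N)" unfolding sum_list_weight[symmetric] L[symmetric] ..
  also have "\<dots> = sum list_weight ?D + sum list_weight ?N"
    using fin by (intro sum.union_disjoint) auto
  finally have eq: "ratio ^ k - m = (\<Sum>vs\<in>?D. list_weight vs - ?P vs) + sum list_weight ?N"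
    by (simp add: m_def sum_subtractf)
  have nn: "0 \<le> ratio ^ k - m" unfolding eq
    using cycle_prob_bounds(2)[OF D] list_weight_nonneg by (intro add_nonneg_nonneg sum_nonneg) auto
  have "(\<Sum>vs\<in>?D. list_weight vs - ?P vs) \<le> (\<Sum>vs\<in>?D. list_weight vs * list_square_sum vs)"
    by (intro sum_mono cycle_prob_bounds(3) D)
  also have "\<dots> \<le> (\<Sum>vs\<in>?L. list_weight vs * list_square_sum vs)"
    using fin list_weight_nonneg list_square_sum_nonneg by (intro sum_mono2) auto
  also have "\<dots> = real k * (ratio ^ (k - 1) * fourth)" using k by (intro sum_list_weight_square_sum) simp
  also have "\<dots> \<le> (real k)\<^sup>2 * (ratio ^ (k - 2) * fourth)"
  proof (intro mult_mono mult_right_mono)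
    have "k - 1 = Suc (k - 2)" using k by simp
    hence "ratio ^ (k - 1) = ratio * ratio ^ (k - 2)" by simp
    also have "\<dots> \<le> 1 * ratio ^ (k - 2)" using ratio_nonneg r by (intro mult_right_mono) auto
    finally show "ratio ^ (k - 1) \<le> ratio ^ (k - 2)" by simp
    show "real k \<le> (real k)\<^sup>2" using k by (simp add: power2_eq_square)
  qed (use ratio_nonneg fourth_nonneg in auto)
  finally have "ratio ^ k - m \<le> 2 * ((real k)\<^sup>2 * (ratio ^ (k - 2) * fourth))"
    unfolding eq using sum_list_weight_nondistinct[of k] k by simp
  hence "(ratio ^ k - m) / (2 * real k) \<le> 2 * ((real k)\<^sup>2 * (ratio ^ (k - 2) * fourth)) / (2 * real k)"
    by (intro divide_right_mono) auto
  also have "\<dots> = real k * ratio ^ (k - 2) * fourth" using k by (simp add: power2_eq_square)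
  finally show ?thesis using nn by (simp flip: diff_divide_distrib)
qed

text \<open>Given the weights, the number of cycles with length in \<open>A\<close> vanishes
  with nearly the Poisson probability. The bound does not depend on \<open>A\<close>, since
  \<open>ratio \<le> q < 1\<close> makes all sums over lengths converge.\<close>

lemma conditional_estimate:
  assumes A: "A \<subseteq> {3..}" and q: "ratio \<le> q" "q < 1"
  shows "\<bar>measure_pmf.prob (grg_given_weights n w) {X. \<forall>a\<in>cycles {1..n} A. \<not> a \<subseteq> X} -
      exp (- (\<Sum>\<^sub>\<infinity>k\<in>A. ratio ^ k / (2 * real k)))\<bar> \<le> 2 * geom_moment q / (1 - q) * fourth"
proof -
  let ?P = "measure_pmf.prob (grg_given_weights n w)"
  let ?p = "\<lambda>a. \<Prod>e\<in>a. edge_prob n w e"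
  let ?C = "cycles {1..n} A"
  let ?D = "\<lambda>k. {vs \<in> lists_of {1..n} k. distinct vs}"
  let ?F = "A \<inter> {3..n}"
  define mu where "mu k = (\<Sum>vs\<in>?D k. ?p (cycle_edges vs)) / (2 * real k)" for k
  have q0: "0 \<le> q" "ratio < 1" using q ratio_nonneg by auto
  have C: "\<exists>vs. a = cycle_edges vs \<and> cycle_list vs \<and> set vs \<subseteq> {1..n}" if "a \<in> ?C" for a
    using that by (auto simp: cycles_def)
  have D: "cycle_list vs" "set vs \<subseteq> {1..n}" "length vs = k" if "vs \<in> ?D k" "k \<in> ?F" for vs k
    using that by (auto simp: lists_of_def cycle_list_def)
  have sub: "a \<subseteq> possible_edges n" if "a \<in> ?C" for a using C[OF that] cycle_edges_possible by auto
  have finC: "finite ?C"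
    by (rule finite_subset[of _ "Pow (possible_edges n)"]) (use sub finite_possible_edges in auto)
  have sum_p: "(\<Sum>a\<in>?C. ?p a) = (\<Sum>k\<in>?F. mu k)"
    by (simp add: sum_over_cycles mu_def sum_divide_distrib)
  have ratio_k: "ratio ^ (k - 1) \<le> q ^ (k - 2)" "ratio ^ (k - 2) \<le> q ^ (k - 2)" if "3 \<le> k" for k
  proof -
    show le: "ratio ^ (k - 2) \<le> q ^ (k - 2)" using ratio_nonneg q by (intro power_mono)
    have "k - 1 = Suc (k - 2)" using that by simp
    hence "ratio ^ (k - 1) = ratio * ratio ^ (k - 2)" by simp
    also have "\<dots> \<le> 1 * q ^ (k - 2)" using le ratio_nonneg q0 by (intro mult_mono) auto
    finally show "ratio ^ (k - 1) \<le> q ^ (k - 2)" by simp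
  qed
  have "\<bar>?P {X. \<forall>a\<in>?C. \<not> a \<subseteq> X} - exp (- (\<Sum>a\<in>?C. ?p a))\<bar>
    \<le> (\<Sum>a\<in>?C. ?p a * ?P {X. ear a (X - a)} + (?p a)\<^sup>2)"
    unfolding grg_given_weights_eq
  proof (rule poisson_approx_no_occurrence[where U = ear and I = "cycles {1..n} A",
        OF finite_possible_edges edge_prob_bounds finC sub])
    fix a b X assume ab: "a \<in> ?C" "b \<in> ?C" "a \<noteq> b" "a \<inter> b \<noteq> {}" "b \<subseteq> X"
    obtain vs where vs: "a = cycle_edges vs" "cycle_list vs" using C[OF ab(1)] by blast
    obtain us where us: "b = cycle_edges us" "cycle_list us" "set us \<subseteq> {1..n}" using C[OF ab(2)] by blast
    have "cycle_edges us \<noteq> cycle_edges vs" "cycle_edges us \<inter> cycle_edges vs \<noteq> {}" using ab(3,4) unfolding vs(1) us(1) by blast+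
    from ear_path_exists[OF us(2) vs(2) this] obtain p where p: "2 \<le> length p" "distinct p" "set p \<subseteq> set us"
        "p ! 0 \<in> set vs" "p ! (length p - 1) \<in> set vs" "path_edges p \<subseteq> cycle_edges us - cycle_edges vs"
      by blast
    have "path_edges p \<subseteq> X - a" "set p \<subseteq> {1..n}"
      using p(3,6) ab(5) us(3) unfolding vs(1) us(1) by blast+
    moreover have "p ! 0 \<in> \<Union> a" "p ! (length p - 1) \<in> \<Union> a"
      using p(4,5) unfolding vs(1) Union_cycle_edges by blast+
    ultimately show "ear a (X - a)" unfolding ear_def using p(1,2) by blast
  qed
  also have "\<dots> = (\<Sum>k\<in>?F. \<Sum>vs\<in>?D k. (?p (cycle_edges vs) * ?P {X. ear (cycle_edges vs) (X - cycle_edges vs)} +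
      (?p (cycle_edges vs))\<^sup>2) / (2 * real k))"
    by (simp add: sum_over_cycles)
  also have "\<dots> \<le> (\<Sum>k\<in>?F. \<Sum>vs\<in>?D k. list_weight vs * list_square_sum vs * ((real k / (1 - q) + 1) / (2 * real k)))"
  proof (intro sum_mono)
    fix k vs assume k: "k \<in> ?F" and vs: "vs \<in> ?D k"
    note D = D[OF vs k] and b = cycle_prob_bounds[OF D(1,2)]
    let ?x = "?p (cycle_edges vs)" and ?M = "list_weight vs" and ?Q = "list_square_sum vs"
    have "?P {X. ear (cycle_edges vs) (X - cycle_edges vs)} \<le> (\<Sum>v\<in>\<Union> (cycle_edges vs). w v)\<^sup>2 / total / (1 - q)"
      using D by (intro ear_prob_le q) (simp add: Union_cycle_edges)
    also have "\<dots> \<le> real k * ?Q / (1 - q)"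
      using vertex_sum_square_le[OF D(1)] D(3) q by (intro divide_right_mono) auto
    finally have e: "?P {X. ear (cycle_edges vs) (X - cycle_edges vs)} \<le> real k * ?Q / (1 - q)" .
    have "?x * ?P {X. ear (cycle_edges vs) (X - cycle_edges vs)} + ?x\<^sup>2 \<le> ?M * (real k * ?Q / (1 - q)) + ?M * ?Q"
      unfolding power2_eq_square using b e list_weight_nonneg[of vs]
      by (intro add_mono mult_mono) auto
    also have "\<dots> = ?M * ?Q * (real k / (1 - q) + 1)" by (simp add: algebra_simps)
    finally have "(?x * ?P {X. ear (cycle_edges vs) (X - cycle_edges vs)} + ?x\<^sup>2) / (2 * real k)
      \<le> ?M * ?Q * (real k / (1 - q) + 1) / (2 * real k)" by (intro divide_right_mono) auto
    thus "(?x * ?P {X. ear (cycle_edges vs) (X - cycle_edges vs)} + ?x\<^sup>2) / (2 * real k)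
      \<le> ?M * ?Q * ((real k / (1 - q) + 1) / (2 * real k))" by simp
  qed
  also have "\<dots> \<le> (\<Sum>k\<in>?F. real k * q ^ (k - 2) * (fourth / (1 - q)))"
  proof (intro sum_mono)
    fix k assume "k \<in> ?F"
    hence k: "3 \<le> k" by simp
    have "(\<Sum>vs\<in>?D k. list_weight vs * list_square_sum vs) \<le> (\<Sum>vs\<in>lists_of {1..n} k. list_weight vs * list_square_sum vs)"
      using list_weight_nonneg list_square_sum_nonneg by (intro sum_mono2 finite_lists_of) auto
    also have "\<dots> = real k * (ratio ^ (k - 1) * fourth)" using k by (intro sum_list_weight_square_sum) simp
    also have "\<dots> \<le> real k * (q ^ (k - 2) * fourth)"
      using ratio_k[OF k] fourth_nonneg by (intro mult_left_mono mult_right_mono) auto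
    finally have 1: "(\<Sum>vs\<in>?D k. list_weight vs * list_square_sum vs) \<le> real k * (q ^ (k - 2) * fourth)" .
    have "1 \<le> real k / (1 - q)" using k q q0 by (simp add: field_simps)
    hence "(real k / (1 - q) + 1) / (2 * real k) \<le> (2 * (real k / (1 - q))) / (2 * real k)"
      by (intro divide_right_mono) auto
    also have "\<dots> = 1 / (1 - q)" using k by simp
    finally have 2: "(real k / (1 - q) + 1) / (2 * real k) \<le> 1 / (1 - q)" .
    have "(\<Sum>vs\<in>?D k. list_weight vs * list_square_sum vs) * ((real k / (1 - q) + 1) / (2 * real k))
      \<le> real k * (q ^ (k - 2) * fourth) * (1 / (1 - q))"
      using 1 2 q q0 fourth_nonneg by (intro mult_mono) auto
    thus "(\<Sum>vs\<in>?D k. list_weight vs * list_square_sum vs * ((real k / (1 - q) + 1) / (2 * real k)))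
      \<le> real k * q ^ (k - 2) * (fourth / (1 - q))"
      by (simp only: sum_distrib_right[symmetric]) (simp add: mult_ac)
  qed
  also have "\<dots> = (\<Sum>k\<in>?F. real k * q ^ (k - 2)) * (fourth / (1 - q))"
    by (rule sum_distrib_right[symmetric])
  also have "\<dots> \<le> geom_moment q * (fourth / (1 - q))"
    using q q0 fourth_nonneg by (intro mult_right_mono sum_le_geom_moment) auto
  finally have 1: "\<bar>?P {X. \<forall>a\<in>?C. \<not> a \<subseteq> X} - exp (- (\<Sum>a\<in>?C. ?p a))\<bar> \<le> geom_moment q * (fourth / (1 - q))" .
  have mu0: "mu k = 0" if "k \<in> A - ?F" for k
  proof -
    have "n < k" using that A by auto
    moreover have "length vs \<le> n" if "distinct vs" "set vs \<subseteq> {1..n}" for vs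
      using card_mono[OF _ that(2)] distinct_card[OF that(1)] by simp
    ultimately have "?D k = {}" unfolding lists_of_def by (fastforce simp: not_le[symmetric])
    thus ?thesis unfolding mu_def by (simp only: sum.empty div_0)
  qed
  have "(mu has_sum (\<Sum>k\<in>?F. mu k)) A"
    by (rule has_sum_finite_neutralI) (use mu0 in auto)
  hence mu_sum: "mu summable_on A" "(\<Sum>\<^sub>\<infinity>k\<in>A. mu k) = (\<Sum>k\<in>?F. mu k)"
    by (auto simp: summable_on_def infsumI)
  have "\<bar>(\<Sum>\<^sub>\<infinity>k\<in>A. ratio ^ k / (2 * real k)) - (\<Sum>\<^sub>\<infinity>k\<in>A. mu k)\<bar> \<le> geom_moment q * fourth"
  proof (rule infsum_diff_le_geom_moment[OF q0(1) q(2) fourth_nonneg summable_on_rate[OF ratio_nonneg q0(2)] mu_sum(1)])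
    fix k assume "k \<in> A"
    hence k: "3 \<le> k" using A by auto
    have "\<bar>ratio ^ k / (2 * real k) - mu k\<bar> \<le> real k * ratio ^ (k - 2) * fourth"
      unfolding mu_def by (rule cycle_rate_error[OF k q0(2)])
    also have "\<dots> \<le> real k * q ^ (k - 2) * fourth"
      using ratio_k[OF k] fourth_nonneg by (intro mult_left_mono mult_right_mono) auto
    finally show "\<bar>ratio ^ k / (2 * real k) - mu k\<bar> \<le> real k * q ^ (k - 2) * fourth" .
  qed
  moreover have "0 \<le> (\<Sum>\<^sub>\<infinity>k\<in>A. ratio ^ k / (2 * real k))"
    using ratio_nonneg by (intro infsum_nonneg) auto
  moreover have "0 \<le> (\<Sum>\<^sub>\<infinity>k\<in>A. mu k)"
    unfolding mu_sum(2) unfolding mu_def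
    by (intro sum_nonneg divide_nonneg_nonneg cycle_prob_bounds(1) D) auto
  ultimately have 2: "\<bar>exp (- (\<Sum>a\<in>?C. ?p a)) - exp (- (\<Sum>\<^sub>\<infinity>k\<in>A. ratio ^ k / (2 * real k)))\<bar> \<le> geom_moment q * fourth"
    using exp_minus_lipschitz[of "\<Sum>\<^sub>\<infinity>k\<in>A. mu k" "\<Sum>\<^sub>\<infinity>k\<in>A. ratio ^ k / (2 * real k)"]
    unfolding sum_p mu_sum(2)[symmetric] by (simp add: abs_minus_commute)
  have "geom_moment q * fourth \<le> geom_moment q * (fourth / (1 - q))"
    using q q0 fourth_nonneg geom_moment_nonneg[OF q0(1)]
    by (intro mult_left_mono) (auto simp: field_simps mult_left_le)
  moreover have "2 * geom_moment q / (1 - q) * fourth =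
      geom_moment q * (fourth / (1 - q)) + geom_moment q * (fourth / (1 - q))" by simp
  ultimately show ?thesis using 1 2 by linarith
qed

end

section \<open>Expansion around the limiting rate\<close>

definition rate_sum :: "nat set \<Rightarrow> real \<Rightarrow> real" where
  "rate_sum A r = (\<Sum>\<^sub>\<infinity>k\<in>A. r ^ k / (2 * real k))"

text \<open>The derivative of \<open>rate_sum A\<close>, term by term.\<close>

definition rate_slope :: "nat set \<Rightarrow> real \<Rightarrow> real" where
  "rate_slope A r = (\<Sum>\<^sub>\<infinity>k\<in>A. r ^ (k - 1) / 2)"

lemma power_diff_le:
  fixes r s q :: real
  assumes "0 \<le> r" "r \<le> q" "0 \<le> s" "s \<le> q"
  shows "\<bar>r ^ Suc j - s ^ Suc j\<bar> \<le> real (Suc j) * q ^ j * \<bar>r - s\<bar>"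
proof (induction j)
  case (Suc j)
  have q: "0 \<le> q" using assms by linarith
  have "r ^ Suc (Suc j) - s ^ Suc (Suc j) = r * (r ^ Suc j - s ^ Suc j) + s ^ Suc j * (r - s)"
    by (simp add: algebra_simps)
  hence "\<bar>r ^ Suc (Suc j) - s ^ Suc (Suc j)\<bar> \<le> r * \<bar>r ^ Suc j - s ^ Suc j\<bar> + s ^ Suc j * \<bar>r - s\<bar>"
    using assms abs_triangle_ineq[of "r * (r ^ Suc j - s ^ Suc j)" "s ^ Suc j * (r - s)"]
    by (simp add: abs_mult)
  also have "\<dots> \<le> q * (real (Suc j) * q ^ j * \<bar>r - s\<bar>) + q ^ Suc j * \<bar>r - s\<bar>"
    using assms Suc q by (intro add_mono mult_mono power_mono) auto
  also have "\<dots> = real (Suc (Suc j)) * q ^ Suc j * \<bar>r - s\<bar>" by (simp add: algebra_simps)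
  finally show ?case .
qed simp

lemma power_taylor:
  fixes r s q :: real
  assumes "0 \<le> r" "r \<le> q" "0 \<le> s" "s \<le> q"
  shows "\<bar>r ^ (j + 2) - s ^ (j + 2) - real (j + 2) * s ^ (j + 1) * (r - s)\<bar> \<le> (real (j + 2))\<^sup>2 * q ^ j * (r - s)\<^sup>2"
proof (induction j)
  case 0
  have "r\<^sup>2 - s\<^sup>2 - 2 * s * (r - s) = (r - s)\<^sup>2" by (simp add: algebra_simps power2_eq_square)
  thus ?case by (simp add: numeral_2_eq_2)
next
  case (Suc j)
  let ?T = "r ^ (j + 2) - s ^ (j + 2) - real (j + 2) * s ^ (j + 1) * (r - s)"
  have triangle: "\<bar>r * T + c\<bar> \<le> r * \<bar>T\<bar> + c" if "0 \<le> c" for T c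
    using abs_triangle_ineq[of "r * T" c] that assms(1) by (simp add: abs_mult)
  have q: "0 \<le> q" using assms by linarith
  have eq: "r ^ (Suc j + 2) - s ^ (Suc j + 2) - real (Suc j + 2) * s ^ (Suc j + 1) * (r - s) =
      r * ?T + real (j + 2) * s ^ (j + 1) * (r - s)\<^sup>2"
    by (simp add: algebra_simps power2_eq_square)
  have "\<bar>r ^ (Suc j + 2) - s ^ (Suc j + 2) - real (Suc j + 2) * s ^ (Suc j + 1) * (r - s)\<bar>
      \<le> r * \<bar>?T\<bar> + real (j + 2) * s ^ (j + 1) * (r - s)\<^sup>2"
    unfolding eq using assms(3) by (intro triangle) simp
  also have "\<dots> \<le> q * ((real (j + 2))\<^sup>2 * q ^ j * (r - s)\<^sup>2) + real (j + 2) * q ^ (j + 1) * (r - s)\<^sup>2"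
  proof (intro add_mono)
    show "r * \<bar>?T\<bar> \<le> q * ((real (j + 2))\<^sup>2 * q ^ j * (r - s)\<^sup>2)"
      by (rule mult_mono[OF assms(2) Suc q]) simp
    show "real (j + 2) * s ^ (j + 1) * (r - s)\<^sup>2 \<le> real (j + 2) * q ^ (j + 1) * (r - s)\<^sup>2"
      using assms by (intro mult_right_mono mult_left_mono power_mono) auto
  qed
  also have "\<dots> = ((real (j + 2))\<^sup>2 + real (j + 2)) * (q ^ (j + 1) * (r - s)\<^sup>2)"
    by (simp add: algebra_simps)
  also have "\<dots> \<le> (real (Suc j + 2))\<^sup>2 * (q ^ (j + 1) * (r - s)\<^sup>2)"
  proof (rule mult_right_mono)
    show "(real (j + 2))\<^sup>2 + real (j + 2) \<le> (real (Suc j + 2))\<^sup>2"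
      by (simp add: power2_eq_square algebra_simps)
  qed (use q in simp)
  finally show ?case by simp
qed

lemma summable_on_rate_slope:
  fixes s :: real assumes "0 \<le> s" "s < 1"
  shows "(\<lambda>k. s ^ (k - 1) / 2) summable_on A"
proof -
  have "summable (\<lambda>k. s ^ (Suc k - 1) / 2)" using assms by (simp add: summable_divide summable_geometric)
  hence "summable (\<lambda>k. s ^ (k - 1) / 2)" by (subst (asm) summable_Suc_iff)
  hence "(\<lambda>k. s ^ (k - 1) / 2) summable_on UNIV" using assms
    by (intro norm_summable_imp_summable_on) simp
  thus ?thesis by (rule summable_on_subset_banach) simp
qed

text \<open>The remainder of order \<open>k\<^sup>2 * q ^ (k - 2)\<close> in the expansion of
  \<open>r ^ k\<close> is divided by \<open>2 * k\<close>, so \<open>geom_moment\<close> bounds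
  the second-order remainder as well, for all \<open>A\<close> at once.\<close>

lemma
  assumes A: "A \<subseteq> {3..}" and r: "0 \<le> r" "r \<le> q" and s: "0 \<le> s" "s \<le> q" and q: "q < 1"
  shows rate_sum_lipschitz: "\<bar>rate_sum A r - rate_sum A s\<bar> \<le> geom_moment q * \<bar>r - s\<bar>"
    and rate_sum_taylor:
      "\<bar>rate_sum A r - rate_sum A s - rate_slope A s * (r - s)\<bar> \<le> geom_moment q * (r - s)\<^sup>2"
    and rate_slope_bounds: "0 \<le> rate_slope A s" "rate_slope A s \<le> geom_moment q"
    and rate_sum_nonneg: "0 \<le> rate_sum A r"
proof -
  have q0: "0 \<le> q" "r < 1" "s < 1" using r s q by linarith+
  note sums = summable_on_rate[OF r(1) q0(2), of A] summable_on_rate[OF s(1) q0(3), of A]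
    summable_on_rate_slope[OF s(1) q0(3), of A]
  have ex: "\<exists>j. k = j + 2" if "k \<in> A" for k
    using A that by (intro exI[of _ "k - 2"]) auto
  show "\<bar>rate_sum A r - rate_sum A s\<bar> \<le> geom_moment q * \<bar>r - s\<bar>"
    unfolding rate_sum_def
  proof (rule infsum_diff_le_geom_moment[OF q0(1) q _ sums(1,2)])
    fix k assume "k \<in> A"
    then obtain j where j: "k = j + 2" using ex by blast
    have "\<bar>r ^ k - s ^ k\<bar> \<le> real k * q ^ (j + 1) * \<bar>r - s\<bar>"
      using power_diff_le[OF r s, of "j + 1"] by (simp add: j)
    hence "\<bar>r ^ k - s ^ k\<bar> / (2 * real k) \<le> real k * q ^ (j + 1) * \<bar>r - s\<bar> / (2 * real k)"
      by (intro divide_right_mono) auto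
    also have "\<dots> = q ^ j * \<bar>r - s\<bar> * (q / 2)" by (simp add: j field_simps)
    also have "\<dots> \<le> q ^ j * \<bar>r - s\<bar> * real k" using q0 q by (intro mult_left_mono) (auto simp: j)
    finally show "\<bar>r ^ k / (2 * real k) - s ^ k / (2 * real k)\<bar> \<le> real k * q ^ (k - 2) * \<bar>r - s\<bar>"
      by (simp add: j mult_ac flip: diff_divide_distrib)
  qed simp
  have "rate_sum A s + rate_slope A s * (r - s) =
      (\<Sum>\<^sub>\<infinity>k\<in>A. s ^ k / (2 * real k) + s ^ (k - 1) / 2 * (r - s))"
    unfolding rate_sum_def rate_slope_def
    by (subst infsum_add[OF sums(2) summable_on_cmult_left[OF sums(3)]]) (simp only: infsum_cmult_left')
  moreover have "\<bar>(\<Sum>\<^sub>\<infinity>k\<in>A. r ^ k / (2 * real k)) -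
      (\<Sum>\<^sub>\<infinity>k\<in>A. s ^ k / (2 * real k) + s ^ (k - 1) / 2 * (r - s))\<bar> \<le> geom_moment q * (r - s)\<^sup>2"
  proof (rule infsum_diff_le_geom_moment[OF q0(1) q _ sums(1) summable_on_add[OF sums(2) summable_on_cmult_left[OF sums(3)]]])
    fix k assume "k \<in> A"
    then obtain j where j: "k = j + 2" using ex by blast
    have "\<bar>r ^ k - s ^ k - real k * s ^ (k - 1) * (r - s)\<bar> \<le> (real k)\<^sup>2 * q ^ j * (r - s)\<^sup>2"
      using power_taylor[OF r s, of j] by (simp add: j)
    hence "\<bar>r ^ k - s ^ k - real k * s ^ (k - 1) * (r - s)\<bar> / (2 * real k)
        \<le> (real k)\<^sup>2 * q ^ j * (r - s)\<^sup>2 / (2 * real k)"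
      by (intro divide_right_mono) auto
    also have "\<dots> = real k * q ^ j * (r - s)\<^sup>2 / 2"
    proof -
      have "k \<noteq> 0" by (simp add: j)
      thus ?thesis by (simp add: power2_eq_square)
    qed
    also have "\<dots> \<le> real k * q ^ j * (r - s)\<^sup>2"
      using q0 by simp
    also have "\<bar>r ^ k - s ^ k - real k * s ^ (k - 1) * (r - s)\<bar> / (2 * real k) =
        \<bar>(r ^ k - s ^ k - real k * s ^ (k - 1) * (r - s)) / (2 * real k)\<bar>" by simp
    also have "(r ^ k - s ^ k - real k * s ^ (k - 1) * (r - s)) / (2 * real k) =
        r ^ k / (2 * real k) - (s ^ k / (2 * real k) + s ^ (k - 1) / 2 * (r - s))"
    proof -
      have "k \<noteq> 0" by (simp add: j)
      thus ?thesis by (simp add: diff_divide_distrib)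
    qed
    finally show "\<bar>r ^ k / (2 * real k) - (s ^ k / (2 * real k) + s ^ (k - 1) / 2 * (r - s))\<bar>
        \<le> real k * q ^ (k - 2) * (r - s)\<^sup>2" by (simp add: j)
  qed simp
  ultimately show "\<bar>rate_sum A r - rate_sum A s - rate_slope A s * (r - s)\<bar> \<le> geom_moment q * (r - s)\<^sup>2"
    unfolding rate_sum_def by (simp add: algebra_simps)
  show pos: "0 \<le> rate_slope A s" unfolding rate_slope_def using s by (intro infsum_nonneg) auto
  have "\<bar>rate_slope A s - (\<Sum>\<^sub>\<infinity>k\<in>A. 0)\<bar> \<le> geom_moment q * 1"
    unfolding rate_slope_def
  proof (rule infsum_diff_le_geom_moment[OF q0(1) q _ sums(3)])
    fix k assume "k \<in> A"
    then obtain j where j: "k = j + 2" using ex by blast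
    have "s ^ (j + 1) / 2 = s ^ j * (s / 2)" by simp
    also have "\<dots> \<le> q ^ j * real k" using s q0 by (intro mult_mono power_mono) (auto simp: j)
    finally show "\<bar>s ^ (k - 1) / 2 - 0\<bar> \<le> real k * q ^ (k - 2) * 1"
      using s by (simp add: j mult.commute)
  qed simp_all
  thus "rate_slope A s \<le> geom_moment q" using pos by simp
  show "0 \<le> rate_sum A r" unfolding rate_sum_def using r by (intro infsum_nonneg) auto
qed

lemma exp_minus_taylor:
  fixes x y :: real
  assumes "0 \<le> x" "0 \<le> y"
  shows "\<bar>exp (- x) - exp (- y) + exp (- y) * (x - y)\<bar> \<le> (x - y)\<^sup>2"
proof (cases "y \<le> x")
  case True
  have "exp (- x) - exp (- y) + exp (- y) * (x - y) = exp (- y) * (exp (- (x - y)) - (1 - (x - y)))"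
    by (simp add: algebra_simps flip: exp_add)
  also have "\<bar>\<dots>\<bar> \<le> 1 * (x - y)\<^sup>2"
    unfolding abs_mult using assms True one_minus_exp_bounds[of "x - y"] by (intro mult_mono) auto
  finally show ?thesis by simp
next
  case False
  define u where "u = y - x"
  have u: "0 < u" using False by (simp add: u_def)
  have "1 - u \<le> exp (- u)" using exp_ge_add_one_self[of "- u"] by simp
  hence "(1 + u) * (1 - u) \<le> (1 + u) * exp (- u)" using u by (intro mult_left_mono) auto
  hence 1: "1 - (1 + u) * exp (- u) \<le> u\<^sup>2" by (simp add: algebra_simps power2_eq_square)
  have "(1 + u) * exp (- u) \<le> exp u * exp (- u)"
    using exp_ge_add_one_self[of u] by (intro mult_right_mono) auto
  hence 2: "0 \<le> 1 - (1 + u) * exp (- u)" by (simp flip: exp_add)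
  have "exp (- x) - exp (- y) + exp (- y) * (x - y) = exp (- x) * (1 - (1 + u) * exp (- u))"
    by (simp add: algebra_simps u_def flip: exp_add)
  also have "\<bar>\<dots>\<bar> \<le> 1 * u\<^sup>2"
    unfolding abs_mult using assms 1 2 by (intro mult_mono) auto
  finally show ?thesis by (simp add: u_def power2_commute)
qed

text \<open>The value \<open>q = (1 + th) / 2\<close> lies midway between \<open>th\<close> and
  1: weights with \<open>ratio > q\<close> are atypical, and below \<open>q\<close> all
  geometric sums converge uniformly.\<close>

definition approx_const :: "real \<Rightarrow> real" where
  "approx_const th = (let q = (1 + th) / 2; K = geom_moment q in
     8 * K / (1 - q) + 4 * K\<^sup>2 + 6 * K + 4 * (1 + K) / (q - th)\<^sup>2)"

context positive_weights
begin

text \<open>The expansion of the conditional probability around its deterministic limit. As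
  \<open>ratio - th = Z / total\<close>, the linear term is a multiple of \<open>Z /
  total\<close>; replacing \<open>total\<close> by \<open>m * n\<close> makes it a multiple of
  \<open>Z\<close> alone, which is centred when \<open>m\<close> and \<open>th\<close> come from
  the weight law. The estimate holds for all positive weights: for atypical ones, where
  \<open>total\<close> is small or \<open>ratio\<close> exceeds \<open>q\<close>, the right-hand
  side exceeds a trivial bound for the left-hand side, as in the proof of the inequality of
  Chebyshev.\<close>

lemma pointwise_estimate:
  assumes A: "A \<subseteq> {3..}" and m: "0 < m" and th: "0 \<le> th" "th < 1"
  defines "Y \<equiv> total - m * real n" and "Z \<equiv> \<Sum>i=1..n. (w i)\<^sup>2 - th * w i"
    and "F \<equiv> \<Sum>i=1..n. w i ^ 4"
  shows "\<bar>measure_pmf.prob (grg_given_weights n w) {X. \<forall>a\<in>cycles {1..n} A. \<not> a \<subseteq> X} - exp (- rate_sum A th)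
      + exp (- rate_sum A th) * rate_slope A th * (Z / (m * real n))\<bar>
    \<le> approx_const th * (F + Y\<^sup>2 + Z\<^sup>2) / (m * real n)\<^sup>2"
proof -
  let ?P = "measure_pmf.prob (grg_given_weights n w) {X. \<forall>a\<in>cycles {1..n} A. \<not> a \<subseteq> X}"
  define q where "q = (1 + th) / 2"
  define K where "K = geom_moment q"
  define t where "t = m * real n"
  define g where "g = exp (- rate_sum A th)"
  define S where "S = rate_slope A th"
  have q: "0 \<le> q" "q < 1" "th \<le> q" "th < q" using th by (auto simp: q_def)
  have K: "0 \<le> K" unfolding K_def by (rule geom_moment_nonneg[OF q(1)])
  have t: "0 < t" using m n_pos by (simp add: t_def)
  have g: "0 \<le> g" "g \<le> 1"
    using rate_sum_nonneg[OF A th(1) q(3) th(1) q(3) q(2)] by (auto simp: g_def)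
  have S: "0 \<le> S" "S \<le> K"
    using rate_slope_bounds[OF A th(1) q(3) th(1) q(3) q(2)] by (auto simp: S_def K_def)
  have gS: "0 \<le> g * S" "g * S \<le> K" using g S K mult_mono[of g 1 S K] by auto
  have F: "0 \<le> F" by (auto simp: F_def intro!: sum_nonneg)
  have Z: "ratio - th = Z / total"
    using total_pos by (simp add: Z_def ratio_def field_simps sum_subtractf total_def sum_distrib_left)
  define a b c where "a = F / t\<^sup>2" and "b = Y\<^sup>2 / t\<^sup>2" and "c = Z\<^sup>2 / t\<^sup>2"
  have abc: "0 \<le> a" "0 \<le> b" "0 \<le> c" using F by (auto simp: a_def b_def c_def)
  define d where "d = 4 / (q - th)\<^sup>2"
  have d: "0 \<le> d" by (simp add: d_def)
  define e where "e = 8 * K / (1 - q)"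
  have e: "0 \<le> e" using K q by (simp add: e_def)
  have const: "approx_const th = e + 4 * K\<^sup>2 + 6 * K + (1 + K) * d"
    by (simp add: approx_const_def Let_def q_def K_def d_def e_def)
  have "\<bar>?P - g + g * S * (Z / t)\<bar> \<le> approx_const th * (a + b + c)"
  \<comment> \<open>the first case is that of typical weights\<close>
  proof (cases "t / 2 \<le> total \<and> ratio \<le> q")
    case True
    have inv: "(x / total)\<^sup>2 \<le> 4 * (x\<^sup>2 / t\<^sup>2)" for x
    proof -
      have "(t / 2)\<^sup>2 \<le> total\<^sup>2" using True t by (intro power_mono) auto
      hence "x\<^sup>2 / total\<^sup>2 \<le> x\<^sup>2 / (t / 2)\<^sup>2" using t total_pos by (intro divide_left_mono) auto
      thus ?thesis by (simp add: power_divide mult.commute)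
    qed
    have "fourth \<le> 4 * a"
    proof -
      have "(t / 2)\<^sup>2 \<le> total\<^sup>2" using True t by (intro power_mono) auto
      hence "F / total\<^sup>2 \<le> F / (t / 2)\<^sup>2" using t total_pos F by (intro divide_left_mono) auto
      thus ?thesis by (simp add: power_divide a_def fourth_def F_def mult.commute)
    qed
    hence "2 * K / (1 - q) * fourth \<le> 2 * K / (1 - q) * (4 * a)"
      using K q by (intro mult_left_mono) auto
    moreover have "\<bar>?P - exp (- rate_sum A ratio)\<bar> \<le> 2 * K / (1 - q) * fourth"
      unfolding rate_sum_def K_def using True by (intro conditional_estimate A q(2)) auto
    ultimately have 1: "\<bar>?P - exp (- rate_sum A ratio)\<bar> \<le> e * a" by (simp add: e_def)
    note rates = A ratio_nonneg conjunct2[OF True] th(1) q(3) q(2)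
    have z: "(ratio - th)\<^sup>2 \<le> 4 * c" unfolding Z c_def by (rule inv)
    have "\<bar>exp (- rate_sum A ratio) - g + g * (rate_sum A ratio - rate_sum A th)\<bar>
        \<le> (rate_sum A ratio - rate_sum A th)\<^sup>2"
      unfolding g_def
      by (intro exp_minus_taylor rate_sum_nonneg[OF rates] rate_sum_nonneg[OF A th(1) q(3) th(1) q(3) q(2)])
    also have "\<dots> \<le> (K * \<bar>ratio - th\<bar>)\<^sup>2"
      using rate_sum_lipschitz[OF rates] by (intro power2_le_iff_abs_le[THEN iffD2]) (auto simp: K K_def[symmetric])
    also have "\<dots> = K\<^sup>2 * (ratio - th)\<^sup>2" by (simp add: power_mult_distrib)
    also have "\<dots> \<le> K\<^sup>2 * (4 * c)" using z by (intro mult_left_mono) auto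
    finally have 2: "\<bar>exp (- rate_sum A ratio) - g + g * (rate_sum A ratio - rate_sum A th)\<bar> \<le> 4 * K\<^sup>2 * c" by simp
    have "\<bar>g * (rate_sum A ratio - rate_sum A th) - g * S * (ratio - th)\<bar> =
        g * \<bar>rate_sum A ratio - rate_sum A th - S * (ratio - th)\<bar>"
    proof -
      have "g * (rate_sum A ratio - rate_sum A th) - g * S * (ratio - th) =
          g * (rate_sum A ratio - rate_sum A th - S * (ratio - th))" by (simp add: algebra_simps)
      thus ?thesis using g by (simp only: abs_mult abs_of_nonneg)
    qed
    also have "\<dots> \<le> 1 * (K * (ratio - th)\<^sup>2)"
      using g K rate_sum_taylor[OF rates] by (intro mult_mono) (auto simp: S_def K_def)
    also have "\<dots> \<le> 1 * (K * (4 * c))" using z K by (intro mult_mono) auto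
    finally have 3: "\<bar>g * (rate_sum A ratio - rate_sum A th) - g * S * (ratio - th)\<bar> \<le> 4 * K * c" by simp
    \<comment> \<open>a product of two fluctuations, hence again of second order\<close>
    have "\<bar>Z / total - Z / t\<bar> = \<bar>Z\<bar> * \<bar>Y\<bar> / (total * t)"
    proof -
      have "Z / total - Z / t = - (Z * Y) / (total * t)"
      proof -
        have "- (Z * Y) = Z * t - Z * total" by (simp add: Y_def t_def algebra_simps)
        thus ?thesis using total_pos t by (simp add: diff_divide_distrib)
      qed
      thus ?thesis using total_pos t by (simp add: abs_mult)
    qed
    also have "\<dots> \<le> \<bar>Z\<bar> * \<bar>Y\<bar> / (t / 2 * t)"
      using True t total_pos by (intro divide_left_mono mult_right_mono) auto
    also have "\<dots> = 2 * \<bar>Z\<bar> * \<bar>Y\<bar> / t\<^sup>2" by (simp add: power2_eq_square)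
    also have "\<dots> \<le> (Z\<^sup>2 + Y\<^sup>2) / t\<^sup>2"
      using sum_squares_bound[of "\<bar>Z\<bar>" "\<bar>Y\<bar>"] by (intro divide_right_mono) auto
    finally have "\<bar>Z / total - Z / t\<bar> \<le> b + c" by (simp add: b_def c_def add_divide_distrib)
    hence "g * S * \<bar>Z / total - Z / t\<bar> \<le> K * (b + c)" using gS abc by (intro mult_mono) auto
    hence 4: "\<bar>g * S * (ratio - th) - g * S * (Z / t)\<bar> \<le> K * (b + c)"
      using gS(1) unfolding Z right_diff_distrib[symmetric] abs_mult[of "g * S"] by simp
    have "\<bar>?P - g + g * S * (Z / t)\<bar> \<le> e * a + 4 * K\<^sup>2 * c + 4 * K * c + K * (b + c)"
      using 1 2 3 4 by linarith
    also have "\<dots> \<le> approx_const th * (a + b + c)"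
    proof -
      have "0 \<le> e * (b + c)" "0 \<le> 4 * K\<^sup>2 * (a + b)" "0 \<le> K * (6 * a + 5 * b + c)"
        "0 \<le> (1 + K) * d * (a + b + c)"
        using abc K e d by (intro mult_nonneg_nonneg add_nonneg_nonneg; simp)+
      thus ?thesis unfolding const by (simp add: algebra_simps)
    qed
    finally show ?thesis .
  next
    case False
    have "1 \<le> d * (b + c)"
    proof (cases "t / 2 \<le> total")
      case True
      hence "(q - th) * (t / 2) \<le> (ratio - th) * total"
        using False q t total_pos by (intro mult_mono) auto
      also have "\<dots> = Z" unfolding Z using total_pos by simp
      finally have "((q - th) * (t / 2))\<^sup>2 \<le> Z\<^sup>2" using q t by (intro power_mono) auto
      hence "(q - th)\<^sup>2 * t\<^sup>2 \<le> 4 * Z\<^sup>2" by (simp add: power_mult_distrib power_divide)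
      hence "1 \<le> 4 * Z\<^sup>2 / ((q - th)\<^sup>2 * t\<^sup>2)" using q t by (simp add: le_divide_eq)
      hence "1 \<le> d * c" by (simp add: d_def c_def)
      thus ?thesis using d abc by (simp add: distrib_left add_increasing)
    next
      case False
      moreover have "Y = total - t" by (simp add: Y_def t_def)
      ultimately have "t / 2 \<le> \<bar>Y\<bar>" by linarith
      hence "(t / 2)\<^sup>2 \<le> \<bar>Y\<bar>\<^sup>2" using t by (intro power_mono) auto
      hence "1 \<le> 4 * b" using t by (simp add: b_def field_simps power_divide)
      also have "\<dots> \<le> d * b"
      proof (intro mult_right_mono abc)
        have "(q - th)\<^sup>2 \<le> 1" using q th by (intro power_le_one) (auto simp: q_def)
        thus "4 \<le> d" using q by (simp add: d_def le_divide_eq)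
      qed
      finally show ?thesis using d abc by (simp add: distrib_left add_increasing2)
    qed
    hence big: "(1 + K) * 1 \<le> (1 + K) * (d * (b + c))" using K by (intro mult_left_mono) auto
    have abs_le: "\<bar>x\<bar> \<le> 1 + x\<^sup>2" for x :: real
    proof -
      have "2 * \<bar>x\<bar> \<le> 1 + x\<^sup>2" using sum_squares_bound[of 1 "\<bar>x\<bar>"] by simp
      thus ?thesis using abs_ge_zero[of x] by linarith
    qed
    from abs_le[of "Z / t"] have "\<bar>Z / t\<bar> \<le> 1 + c" by (simp add: c_def power_divide)
    hence slope: "g * S * \<bar>Z / t\<bar> \<le> K * (1 + c)" using gS K by (intro mult_mono) auto
    have abs_slope: "\<bar>g * S * (Z / t)\<bar> = g * S * \<bar>Z / t\<bar>" using gS(1) by (simp only: abs_mult[of "g * S"] abs_of_nonneg)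
    have "0 \<le> ?P" "?P \<le> 1" by simp_all
    with g have diff: "\<bar>?P - g\<bar> \<le> 1" by linarith
    have "\<bar>?P - g + g * S * (Z / t)\<bar> \<le> \<bar>?P - g\<bar> + \<bar>g * S * (Z / t)\<bar>" by (rule abs_triangle_ineq)
    also have "\<dots> \<le> 1 + K * (1 + c)" using diff slope unfolding abs_slope by (rule add_mono)
    also have "\<dots> \<le> (1 + K) * (d * (b + c)) + K * c" using big by (simp add: algebra_simps)
    also have "\<dots> \<le> approx_const th * (a + b + c)"
    proof -
      have "0 \<le> (e + 4 * K\<^sup>2) * (a + b + c)" "0 \<le> K * (6 * a + 6 * b + 5 * c)"
        "0 \<le> (1 + K) * d * a"
        using abc K e d by (intro mult_nonneg_nonneg add_nonneg_nonneg; simp)+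
      thus ?thesis unfolding const by (simp add: algebra_simps)
    qed
    finally show ?thesis .
  qed
  also have "approx_const th * (a + b + c) = approx_const th * (F + Y\<^sup>2 + Z\<^sup>2) / t\<^sup>2"
    by (simp add: a_def b_def c_def add_divide_distrib distrib_left)
  finally show ?thesis by (simp add: g_def S_def t_def)
qed

end

section \<open>Random weights\<close>

text \<open>The weights are positive only almost surely, so measurability of the conditional law
  has to be proved for arbitrary real weights, where the edge probabilities may leave the unit
  interval.\<close>

lemma pmf_bernoulli_clamped:
  "pmf (bernoulli_pmf p) b = (if b then min 1 (max 0 p) else 1 - min 1 (max 0 p))"
  by (simp add: bernoulli_pmf.rep_eq)

lemma edge_prob_measurable:
  assumes "sets D = sets borel" "e \<in> possible_edges n"
  shows "(\<lambda>w. edge_prob n w e) \<in> borel_measurable (\<Pi>\<^sub>M i\<in>{1..n}. D)"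
proof -
  have component [measurable]: "(\<lambda>w. w i) \<in> borel_measurable (\<Pi>\<^sub>M i\<in>{1..n}. D)" if "i \<in> {1..n}" for i
    using measurable_component_singleton[OF that, of "\<lambda>_. D"] measurable_cong_sets[OF refl assms(1)] by blast
  have "e \<subseteq> {1..n}" using assms by (simp add: possible_edges_def)
  hence [measurable]: "(\<lambda>w. \<Prod>i\<in>e. w i) \<in> borel_measurable (\<Pi>\<^sub>M i\<in>{1..n}. D)"
    by (intro borel_measurable_prod) (use component in auto)
  have [measurable]: "(\<lambda>w. \<Sum>i=1..n. w i) \<in> borel_measurable (\<Pi>\<^sub>M i\<in>{1..n}. D)"
    by (intro borel_measurable_sum component)
  show ?thesis unfolding edge_prob_def by measurable
qed

text \<open>Only finitely many graphs have positive probability, so the probability of any event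
  is a finite sum of products of edge probabilities.\<close>

lemma grg_given_weights_measure_measurable:
  assumes "sets D = sets borel"
  shows "(\<lambda>w. measure_pmf.prob (grg_given_weights n w) X) \<in> borel_measurable (\<Pi>\<^sub>M i\<in>{1..n}. D)"
proof -
  let ?E = "possible_edges n"
  define S where "S = PiE_dflt ?E False (\<lambda>_. UNIV :: bool set)"
  define B where "B = (\<lambda>x. {e \<in> ?E. x e}) -` X \<inter> S"
  note finE = finite_possible_edges[of n]
  have fin: "finite S" unfolding S_def using finE by (intro finite_PiE_dflt) auto
  hence finB: "finite B" by (simp add: B_def)
  have "measure_pmf.prob (grg_given_weights n w) X =
    (\<Sum>x\<in>B. \<Prod>e\<in>?E. pmf (bernoulli_pmf (edge_prob n w e)) (x e))" for w
  proof -
    let ?Q = "Pi_pmf ?E False (\<lambda>e. bernoulli_pmf (edge_prob n w e))"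
    have "measure_pmf.prob (grg_given_weights n w) X = measure_pmf.prob ?Q ((\<lambda>x. {e \<in> ?E. x e}) -` X)"
      by (simp add: grg_given_weights_def)
    also have "\<dots> = measure_pmf.prob ?Q B"
      unfolding B_def using set_Pi_pmf_subset[OF finE, of False "\<lambda>e. bernoulli_pmf (edge_prob n w e)"]
      by (intro measure_pmf.finite_measure_eq_AE) (auto simp: AE_measure_pmf_iff S_def PiE_dflt_def)
    also have "\<dots> = (\<Sum>x\<in>B. pmf ?Q x)" by (rule measure_measure_pmf_finite[OF finB])
    also have "\<dots> = (\<Sum>x\<in>B. \<Prod>e\<in>?E. pmf (bernoulli_pmf (edge_prob n w e)) (x e))"
      by (intro sum.cong refl pmf_Pi' finE) (auto simp: B_def S_def PiE_dflt_def)
    finally show ?thesis .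
  qed
  moreover have "(\<lambda>w. \<Sum>x\<in>B. \<Prod>e\<in>?E. pmf (bernoulli_pmf (edge_prob n w e)) (x e))
      \<in> borel_measurable (\<Pi>\<^sub>M i\<in>{1..n}. D)"
  proof (intro borel_measurable_sum borel_measurable_prod)
    fix x :: "nat set \<Rightarrow> bool" and e assume "e \<in> ?E"
    hence "(\<lambda>w. min 1 (max 0 (edge_prob n w e))) \<in> borel_measurable (\<Pi>\<^sub>M i\<in>{1..n}. D)"
      by (intro borel_measurable_min borel_measurable_max borel_measurable_const edge_prob_measurable assms)
    moreover from this have "(\<lambda>w. 1 - min 1 (max 0 (edge_prob n w e))) \<in> borel_measurable (\<Pi>\<^sub>M i\<in>{1..n}. D)"
      by (intro borel_measurable_diff borel_measurable_const)
    ultimately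
    show "(\<lambda>w. pmf (bernoulli_pmf (edge_prob n w e)) (x e)) \<in> borel_measurable (\<Pi>\<^sub>M i\<in>{1..n}. D)"
      unfolding pmf_bernoulli_clamped by (cases "x e") (simp_all only: if_True if_False)
  qed
  ultimately show ?thesis by simp
qed

lemma grg_kernel_measurable:
  assumes "sets D = sets borel"
  shows "(\<lambda>w. measure_pmf (grg_given_weights n w)) \<in> (\<Pi>\<^sub>M i\<in>{1..n}. D) \<rightarrow>\<^sub>M subprob_algebra (count_space UNIV)"
proof (rule measurable_subprob_algebra)
  fix X :: "nat set set set" 
  show "(\<lambda>w. emeasure (measure_pmf (grg_given_weights n w)) X) \<in> borel_measurable (\<Pi>\<^sub>M i\<in>{1..n}. D)"
    unfolding measure_pmf.emeasure_eq_measure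
    using grg_given_weights_measure_measurable[OF assms] by simp
qed (auto intro: prob_space_imp_subprob_space measure_pmf.prob_space_axioms)

lemma measure_generalised_random_graph:
  assumes "prob_space D" "sets D = sets borel"
  shows "measure (generalised_random_graph D n) X =
    (\<integral>w. measure_pmf.prob (grg_given_weights n w) X \<partial>(\<Pi>\<^sub>M i\<in>{1..n}. D))"
proof -
  interpret P: prob_space "\<Pi>\<^sub>M i\<in>{1..n}. D" by (intro prob_space_PiM assms)
  show ?thesis unfolding generalised_random_graph_def
    by (rule subprob_space.measure_bind[OF prob_space_imp_subprob_space[OF P.prob_space_axioms] grg_kernel_measurable[OF assms(2)]]) simp
qed

lemma space_generalised_random_graph:
  assumes "prob_space D" "sets D = sets borel"
  shows "prob_space (generalised_random_graph D n)" "space (generalised_random_graph D n) = UNIV"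
    "sets (generalised_random_graph D n) = UNIV"
proof -
  interpret P: prob_space "\<Pi>\<^sub>M i\<in>{1..n}. D" by (intro prob_space_PiM assms)
  show "prob_space (generalised_random_graph D n)" unfolding generalised_random_graph_def
    by (rule P.prob_space_bind[OF _ grg_kernel_measurable[OF assms(2)]])
      (simp add: measure_pmf.prob_space_axioms)
  show "sets (generalised_random_graph D n) = UNIV"
    unfolding generalised_random_graph_def
    by (subst sets_bind[where N = "count_space UNIV", OF _ P.not_empty]) simp_all
  thus "space (generalised_random_graph D n) = UNIV"
    using sets_eq_imp_space_eq[of "generalised_random_graph D n" "count_space UNIV"] by simp
qed

lemma
  fixes D :: "'a measure" and f :: "'a \<Rightarrow> real"
  assumes D: "prob_space D" and I: "finite I" "i \<in> I" and f: "integrable D f"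
  shows integrable_PiM_coordinate: "integrable (\<Pi>\<^sub>M i\<in>I. D) (\<lambda>x. f (x i))"
    and integral_PiM_coordinate: "(\<integral>x. f (x i) \<partial>(\<Pi>\<^sub>M i\<in>I. D)) = (\<integral>x. f x \<partial>D)"
proof -
  interpret D: prob_space D by fact
  interpret product_prob_space "\<lambda>_. D" I by unfold_locales
  define g where "g j = (if j = i then f else (\<lambda>_. 1))" for j
  have g: "integrable D (g j)" for j using f by (simp add: g_def)
  have prod: "(\<Prod>j\<in>I. g j (x j)) = f (x i)" for x
    using I by (subst prod.remove[of _ i]) (auto simp: g_def)
  have "(\<Prod>j\<in>I. \<integral>x. g j x \<partial>D) = (\<integral>x. f x \<partial>D)"
    using I by (subst prod.remove[of _ i]) (auto simp: g_def D.prob_space)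
  thus "integrable (\<Pi>\<^sub>M i\<in>I. D) (\<lambda>x. f (x i))" "(\<integral>x. f (x i) \<partial>(\<Pi>\<^sub>M i\<in>I. D)) = (\<integral>x. f x \<partial>D)"
    using product_integrable_prod[OF I(1), of g] product_integral_prod[OF I(1), of g] g
    by (simp_all add: prod)
qed

lemma
  fixes D :: "'a measure" and f :: "'a \<Rightarrow> real"
  assumes D: "prob_space D" and I: "finite I" "i \<in> I" "j \<in> I" "i \<noteq> j"
    and f: "integrable D f" "(\<integral>x. f x \<partial>D) = 0"
  shows integrable_PiM_two_coordinates: "integrable (\<Pi>\<^sub>M i\<in>I. D) (\<lambda>x. f (x i) * f (x j))"
    and integral_PiM_two_coordinates: "(\<integral>x. f (x i) * f (x j) \<partial>(\<Pi>\<^sub>M i\<in>I. D)) = 0"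
proof -
  interpret D: prob_space D by fact
  interpret product_prob_space "\<lambda>_. D" I by unfold_locales
  define g where "g l = (if l = i \<or> l = j then f else (\<lambda>_. 1))" for l
  have g: "integrable D (g l)" for l using f by (simp add: g_def)
  have prod: "(\<Prod>l\<in>I. g l (x l)) = f (x i) * f (x j)" for x
  proof -
    have "(\<Prod>l\<in>I. g l (x l)) = f (x i) * (\<Prod>l\<in>I - {i}. g l (x l))"
      using I by (subst prod.remove[of _ i]) (auto simp: g_def)
    also have "(\<Prod>l\<in>I - {i}. g l (x l)) = f (x j) * (\<Prod>l\<in>I - {i} - {j}. g l (x l))"
      using I by (subst prod.remove[of _ j]) (auto simp: g_def)
    also have "(\<Prod>l\<in>I - {i} - {j}. g l (x l)) = 1"
      by (intro prod.neutral) (auto simp: g_def)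
    finally show ?thesis by simp
  qed
  have "(\<Prod>l\<in>I. \<integral>x. g l x \<partial>D) = 0"
    by (rule prod_zero[OF I(1)]) (use I f in \<open>auto simp: g_def intro!: bexI[of _ i]\<close>)
  thus "integrable (\<Pi>\<^sub>M i\<in>I. D) (\<lambda>x. f (x i) * f (x j))" "(\<integral>x. f (x i) * f (x j) \<partial>(\<Pi>\<^sub>M i\<in>I. D)) = 0"
    using product_integrable_prod[OF I(1), of g] product_integral_prod[OF I(1), of g] g
    by (simp_all add: prod)
qed

lemma
  fixes D :: "'a measure" and f :: "'a \<Rightarrow> real"
  assumes D: "prob_space D" and I: "finite I"
    and f: "integrable D f" "integrable D (\<lambda>x. (f x)\<^sup>2)" "(\<integral>x. f x \<partial>D) = 0"
  shows integrable_PiM_sum_square: "integrable (\<Pi>\<^sub>M i\<in>I. D) (\<lambda>x. (\<Sum>i\<in>I. f (x i))\<^sup>2)"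
    and integral_PiM_sum_square:
      "(\<integral>x. (\<Sum>i\<in>I. f (x i))\<^sup>2 \<partial>(\<Pi>\<^sub>M i\<in>I. D)) = real (card I) * (\<integral>x. (f x)\<^sup>2 \<partial>D)"
proof -
  have sq: "(\<Sum>i\<in>I. f (x i))\<^sup>2 = (\<Sum>i\<in>I. \<Sum>j\<in>I. f (x i) * f (x j))" for x
    by (simp add: power2_eq_square sum_product)
  have pair: "integrable (\<Pi>\<^sub>M i\<in>I. D) (\<lambda>x. f (x i) * f (x j)) \<and>
      (\<integral>x. f (x i) * f (x j) \<partial>(\<Pi>\<^sub>M i\<in>I. D)) = (if i = j then \<integral>x. (f x)\<^sup>2 \<partial>D else 0)"
    if "i \<in> I" "j \<in> I" for i j
  proof (cases "i = j")
    case True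
    thus ?thesis using integrable_PiM_coordinate[OF D I that(1) f(2)] integral_PiM_coordinate[OF D I that(1) f(2)]
      by (simp add: power2_eq_square)
  next
    case False
    thus ?thesis
      using integrable_PiM_two_coordinates[OF D I that False f(1,3)]
        integral_PiM_two_coordinates[OF D I that False f(1,3)] by simp
  qed
  show "integrable (\<Pi>\<^sub>M i\<in>I. D) (\<lambda>x. (\<Sum>i\<in>I. f (x i))\<^sup>2)"
    unfolding sq using pair by (intro Bochner_Integration.integrable_sum) auto
  have "(\<integral>x. (\<Sum>i\<in>I. f (x i))\<^sup>2 \<partial>(\<Pi>\<^sub>M i\<in>I. D)) =
    (\<Sum>i\<in>I. \<Sum>j\<in>I. if i = j then \<integral>x. (f x)\<^sup>2 \<partial>D else 0)"
    unfolding sq using pair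
    by (subst Bochner_Integration.integral_sum; (intro Bochner_Integration.integrable_sum)?; auto)+
  also have "\<dots> = real (card I) * (\<integral>x. (f x)\<^sup>2 \<partial>D)"
    using I by simp
  finally show "(\<integral>x. (\<Sum>i\<in>I. f (x i))\<^sup>2 \<partial>(\<Pi>\<^sub>M i\<in>I. D)) = real (card I) * (\<integral>x. (f x)\<^sup>2 \<partial>D)" .
qed

locale weight_law = prob_space D for D :: "real measure" +
  assumes sets_D [measurable_cong]: "sets D = sets borel"
    and D_pos: "AE x in D. 0 < x"
    and D_fourth: "integrable D (\<lambda>x. x ^ 4)"
    and subcritical: "(\<integral>x. x\<^sup>2 \<partial>D) < (\<integral>x. x \<partial>D)"
begin

definition mean :: real where "mean = (\<integral>x. x \<partial>D)"
definition theta :: real where "theta = (\<integral>x. x\<^sup>2 \<partial>D) / mean"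

lemma integrable_power_le_4:
  assumes "k \<le> 4"
  shows "integrable D (\<lambda>x. x ^ k)"
proof (rule Bochner_Integration.integrable_bound)
  show "integrable D (\<lambda>x. 1 + x ^ 4)" using D_fourth by simp
  show "AE x in D. norm (x ^ k) \<le> norm (1 + x ^ 4)"
  proof (rule AE_I2)
    fix x :: real
    have "\<bar>x\<bar> ^ k \<le> 1 + \<bar>x\<bar> ^ 4"
    proof (cases "\<bar>x\<bar> \<le> 1")
      case True
      hence "\<bar>x\<bar> ^ k \<le> 1" by (intro power_le_one) auto
      thus ?thesis by (simp add: add_increasing2)
    next
      case False
      hence "\<bar>x\<bar> ^ k \<le> \<bar>x\<bar> ^ 4" using assms by (intro power_increasing) auto
      thus ?thesis by simp
    qed
    thus "norm (x ^ k) \<le> norm (1 + x ^ 4)" by (simp add: power_abs)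
  qed
qed measurable

lemma integrable_id: "integrable D (\<lambda>x. x)" and integrable_square: "integrable D (\<lambda>x. x\<^sup>2)"
  using integrable_power_le_4[of 1] integrable_power_le_4[of 2] by simp_all

lemma mean_pos: "0 < mean" and theta_bounds: "0 \<le> theta" "theta < 1"
proof -
  have sq: "0 \<le> (\<integral>x. x\<^sup>2 \<partial>D)" by (intro integral_nonneg_AE) simp
  thus m: "0 < mean" using subcritical unfolding mean_def by linarith
  show "0 \<le> theta" "theta < 1" using sq m subcritical by (auto simp: theta_def mean_def)
qed

text \<open>Its sum over the weights is \<open>(ratio - theta) * total\<close>.\<close>

definition centred_square :: "real \<Rightarrow> real" where
  "centred_square x = x\<^sup>2 - theta * x"

lemma centred_moments:
  "integrable D (\<lambda>x. x - mean)" "integrable D (\<lambda>x. (x - mean)\<^sup>2)" "(\<integral>x. x - mean \<partial>D) = 0"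
  "integrable D centred_square" "integrable D (\<lambda>x. (centred_square x)\<^sup>2)" "(\<integral>x. centred_square x \<partial>D) = 0"
proof -
  note [simp] = integrable_id integrable_square
  have cs: "centred_square = (\<lambda>x. x\<^sup>2 - theta * x)" by (auto simp: centred_square_def)
  show "integrable D (\<lambda>x. x - mean)" by simp
  have "(x - mean)\<^sup>2 = x\<^sup>2 - 2 * mean * x + mean\<^sup>2" for x :: real
    by (simp add: power2_eq_square algebra_simps)
  thus "integrable D (\<lambda>x. (x - mean)\<^sup>2)" by simp
  show "(\<integral>x. x - mean \<partial>D) = 0" by (simp add: prob_space mean_def)
  show "integrable D centred_square" unfolding cs by simp
  have "(centred_square x)\<^sup>2 = x ^ 4 - 2 * theta * x ^ 3 + theta\<^sup>2 * x\<^sup>2" for x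
    by (simp add: centred_square_def power2_eq_square power3_eq_cube power4_eq_xxxx algebra_simps)
  thus "integrable D (\<lambda>x. (centred_square x)\<^sup>2)"
    using integrable_power_le_4[of 3] D_fourth by simp
  have "(\<integral>x. centred_square x \<partial>D) = (\<integral>x. x\<^sup>2 \<partial>D) - theta * mean" unfolding cs by (simp add: mean_def)
  also have "\<dots> = 0" using mean_pos by (simp add: theta_def)
  finally show "(\<integral>x. centred_square x \<partial>D) = 0" .
qed

definition error_const :: real where
  "error_const = approx_const theta / mean\<^sup>2 *
     ((\<integral>x. x ^ 4 \<partial>D) + (\<integral>x. (x - mean)\<^sup>2 \<partial>D) + (\<integral>x. (centred_square x)\<^sup>2 \<partial>D))"

text \<open>The pointwise estimate is integrated: the linear term has mean zero, and each of the
  three error terms is a sum over \<open>n\<close> independent weights with expectation of order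
  \<open>n\<close>, to be divided by \<open>n\<^sup>2\<close>. This is where the fourth moment
  is used.\<close>

theorem no_cycle_estimate:
  assumes A: "A \<subseteq> {3..}" and n: "0 < n"
  shows "\<bar>measure (generalised_random_graph D n) {X. \<forall>a\<in>cycles {1..n} A. \<not> a \<subseteq> X} - exp (- rate_sum A theta)\<bar>
    \<le> error_const / real n"
proof -
  let ?PM = "\<Pi>\<^sub>M i\<in>{1..n}. D"
  interpret P: prob_space ?PM by (intro prob_space_PiM prob_space_axioms)
  let ?N = "{X. \<forall>a\<in>cycles {1..n} A. \<not> a \<subseteq> X}"
  define p where "p w = measure_pmf.prob (grg_given_weights n w) ?N" for w
  define F where "F w = (\<Sum>i=1..n. w i ^ 4)" for w :: "nat \<Rightarrow> real"
  define Y where "Y w = (\<Sum>i=1..n. w i - mean)" for w :: "nat \<Rightarrow> real"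
  define Z where "Z w = (\<Sum>i=1..n. centred_square (w i))" for w :: "nat \<Rightarrow> real"
  define g where "g = exp (- rate_sum A theta)"
  define s where "s = g * rate_slope A theta / (mean * real n)"
  define c where "c = approx_const theta / (mean * real n)\<^sup>2"
  have p_int: "integrable ?PM p"
    using grg_given_weights_measure_measurable[OF sets_D, of n ?N] unfolding p_def
    by (intro P.integrable_const_bound[where B = 1]) auto
  have Z_int: "integrable ?PM Z" "(\<integral>w. Z w \<partial>?PM) = 0"
  proof -
    have *: "integrable ?PM (\<lambda>w. centred_square (w i))" "(\<integral>w. centred_square (w i) \<partial>?PM) = 0" if "i \<in> {1..n}" for i
      using integrable_PiM_coordinate[OF prob_space_axioms _ that centred_moments(4)]
        integral_PiM_coordinate[OF prob_space_axioms _ that centred_moments(4)] centred_moments(6) by simp_all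
    show "integrable ?PM Z" unfolding Z_def by (intro Bochner_Integration.integrable_sum *)
    show "(\<integral>w. Z w \<partial>?PM) = 0" unfolding Z_def
      by (subst Bochner_Integration.integral_sum) (use * in auto)
  qed
  have F_int: "integrable ?PM F" "(\<integral>w. F w \<partial>?PM) = real n * (\<integral>x. x ^ 4 \<partial>D)"
  proof -
    have *: "integrable ?PM (\<lambda>w. w i ^ 4)" "(\<integral>w. w i ^ 4 \<partial>?PM) = (\<integral>x. x ^ 4 \<partial>D)" if "i \<in> {1..n}" for i
      using integrable_PiM_coordinate[OF prob_space_axioms _ that D_fourth]
        integral_PiM_coordinate[OF prob_space_axioms _ that D_fourth] by simp_all
    show "integrable ?PM F" unfolding F_def by (intro Bochner_Integration.integrable_sum *)
    show "(\<integral>w. F w \<partial>?PM) = real n * (\<integral>x. x ^ 4 \<partial>D)" unfolding F_def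
      by (subst Bochner_Integration.integral_sum) (use * in auto)
  qed
  have Y2_int: "integrable ?PM (\<lambda>w. (Y w)\<^sup>2)" "(\<integral>w. (Y w)\<^sup>2 \<partial>?PM) = real n * (\<integral>x. (x - mean)\<^sup>2 \<partial>D)"
    using integrable_PiM_sum_square[OF prob_space_axioms _ centred_moments(1-3), of "{1..n}"]
      integral_PiM_sum_square[OF prob_space_axioms _ centred_moments(1-3), of "{1..n}"]
    by (simp_all add: Y_def)
  have Z2_int: "integrable ?PM (\<lambda>w. (Z w)\<^sup>2)" "(\<integral>w. (Z w)\<^sup>2 \<partial>?PM) = real n * (\<integral>x. (centred_square x)\<^sup>2 \<partial>D)"
    using integrable_PiM_sum_square[OF prob_space_axioms _ centred_moments(4-6), of "{1..n}"]
      integral_PiM_sum_square[OF prob_space_axioms _ centred_moments(4-6), of "{1..n}"]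
    by (simp_all add: Z_def)
  have "AE w in ?PM. \<forall>i\<in>{1..n}. 0 < w i"
    by (intro AE_finite_allI AE_PiM_component prob_space_axioms D_pos) auto
  hence pointwise: "AE w in ?PM. \<bar>p w - g + s * Z w\<bar> \<le> c * (F w + (Y w)\<^sup>2 + (Z w)\<^sup>2)"
  proof eventually_elim
    fix w :: "nat \<Rightarrow> real" assume w: "\<forall>i\<in>{1..n}. 0 < w i"
    interpret positive_weights n w using w n by unfold_locales auto
    have "Y w = total - mean * real n" by (simp add: Y_def total_def sum_subtractf mult.commute)
    thus "\<bar>p w - g + s * Z w\<bar> \<le> c * (F w + (Y w)\<^sup>2 + (Z w)\<^sup>2)"
      using pointwise_estimate[OF A mean_pos theta_bounds]
      by (simp add: p_def g_def s_def c_def F_def Z_def centred_square_def)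
  qed
  let ?h = "\<lambda>w. p w - g + s * Z w" and ?b = "\<lambda>w. c * (F w + (Y w)\<^sup>2 + (Z w)\<^sup>2)"
  have h_int: "integrable ?PM ?h"
    by (intro Bochner_Integration.integrable_add Bochner_Integration.integrable_diff
        P.integrable_const integrable_mult_right p_int Z_int(1))
  have b_int: "integrable ?PM ?b" using F_int Y2_int Z2_int by simp
  have "(\<integral>w. ?h w \<partial>?PM) = (\<integral>w. p w \<partial>?PM) - g"
    using p_int Z_int by (simp add: P.prob_space del: One_nat_def)
  hence "\<bar>(\<integral>w. p w \<partial>?PM) - g\<bar> = \<bar>\<integral>w. ?h w \<partial>?PM\<bar>" by simp
  also have "\<dots> \<le> (\<integral>w. \<bar>?h w\<bar> \<partial>?PM)" by (rule integral_abs_bound)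
  also have "\<dots> \<le> (\<integral>w. ?b w \<partial>?PM)"
    by (intro integral_mono_AE integrable_abs h_int b_int pointwise)
  also have "\<dots> = c * (real n * (\<integral>x. x ^ 4 \<partial>D) + real n * (\<integral>x. (x - mean)\<^sup>2 \<partial>D) +
      real n * (\<integral>x. (centred_square x)\<^sup>2 \<partial>D))"
    using F_int Y2_int Z2_int by simp
  also have "\<dots> = error_const / real n"
    using n mean_pos by (simp add: c_def error_const_def field_simps power2_eq_square)
  finally show ?thesis
    unfolding measure_generalised_random_graph[OF prob_space_axioms sets_D] p_def g_def .
qed

lemma error_const_nonneg: "0 \<le> error_const"
proof -
  have "0 \<le> error_const / real 1" using no_cycle_estimate[of "{}" 1] by (simp add: order_trans[OF abs_ge_zero])
  thus ?thesis by simp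
qed

end

section \<open>Kolmogorov distance of the extreme cycle lengths\<close>

lemma kolmogorov_dist_nat_le:
  fixes f :: "'a \<Rightarrow> nat" and h :: "'b \<Rightarrow> nat"
  assumes "0 \<le> B"
    and B: "\<And>j. \<bar>measure M {x \<in> space M. f x \<le> j} - measure N {y \<in> space N. h y \<le> j}\<bar> \<le> B"
  shows "kolmogorov_dist M (\<lambda>x. real (f x)) N (\<lambda>y. real (h y)) \<le> B"
  unfolding kolmogorov_dist_def
proof (rule cSUP_least)
  fix t :: real
  show "\<bar>measure M {x \<in> space M. real (f x) \<le> t} - measure N {y \<in> space N. real (h y) \<le> t}\<bar> \<le> B"
  proof (cases "0 \<le> t")
    case True
    have "real m \<le> t \<longleftrightarrow> m \<le> nat \<lfloor>t\<rfloor>" for m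
      using True by (simp add: le_nat_iff le_floor_iff)
    thus ?thesis using B[of "nat \<lfloor>t\<rfloor>"] by simp
  next
    case False
    hence "\<not> real m \<le> t" for m using of_nat_0_le_iff[of m, where 'a = real] by linarith
    thus ?thesis using assms(1) by simp
  qed
qed simp

text \<open>The law of the graph lives on all sets of sets of numbers; only subsets of
  \<open>possible_edges n\<close> matter.\<close>

lemma measure_generalised_random_graph_cong:
  assumes "prob_space D" "sets D = sets borel"
    and "\<And>X. X \<subseteq> possible_edges n \<Longrightarrow> X \<in> S \<longleftrightarrow> X \<in> T"
  shows "measure (generalised_random_graph D n) S = measure (generalised_random_graph D n) T"
proof -
  have "measure_pmf.prob (grg_given_weights n w) S = measure_pmf.prob (grg_given_weights n w) T" for w
    by (rule measure_pmf.finite_measure_eq_AE)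
      (auto simp: AE_measure_pmf_iff grg_given_weights_def intro!: assms(3)[THEN iffD1] assms(3)[THEN iffD2])
  thus ?thesis unfolding measure_generalised_random_graph[OF assms(1,2)] by simp
qed

lemma cycle_vertices:
  assumes "X \<subseteq> possible_edges n" "is_cycle X vs"
  shows "cycle_list vs" "cycle_edges vs \<subseteq> X" "set vs \<subseteq> {1..n}"
proof -
  show "cycle_list vs" and sub: "cycle_edges vs \<subseteq> X" using assms(2) by (simp_all add: is_cycle_iff)
  hence "\<Union> (cycle_edges vs) \<subseteq> \<Union> (possible_edges n)" using assms(1) by blast
  also have "\<dots> \<subseteq> {1..n}" by (auto simp: possible_edges_def)
  finally show "set vs \<subseteq> {1..n}" unfolding Union_cycle_edges .
qed

lemma cycle_lengths_subset:
  assumes "X \<subseteq> possible_edges n"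
  shows "cycle_lengths X \<subseteq> {3..n}"
proof
  fix k assume "k \<in> cycle_lengths X"
  then obtain vs where vs: "k = length vs" "is_cycle X vs" by (auto simp: cycle_lengths_def)
  note c = cycle_vertices[OF assms vs(2)]
  have "length vs \<le> n"
    using card_mono[OF _ c(3)] distinct_card[of vs] c(1) by (simp add: cycle_list_def)
  with c(1) vs(1) show "k \<in> {3..n}" by (simp add: cycle_list_def)
qed

lemma no_cycle_iff:
  assumes "X \<subseteq> possible_edges n"
  shows "(\<forall>a\<in>cycles {1..n} A. \<not> a \<subseteq> X) \<longleftrightarrow> cycle_lengths X \<inter> A = {}"
proof -
  have "(\<exists>a\<in>cycles {1..n} A. a \<subseteq> X) \<longleftrightarrow> (\<exists>vs. is_cycle X vs \<and> length vs \<in> A)"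
    using cycle_vertices[OF assms] by (auto simp: cycles_def is_cycle_iff)
  thus ?thesis by (auto simp: cycle_lengths_def)
qed

lemma
  assumes X: "X \<subseteq> possible_edges n"
  shows C_max_le_iff: "3 \<le> j \<Longrightarrow> C_max X \<le> j \<longleftrightarrow> cycle_lengths X \<inter> {j + 1..} = {}"
    and C_max_le_small_iff: "j < 3 \<Longrightarrow> C_max X \<le> j \<longleftrightarrow> cycle_lengths X \<inter> {3..} = {}"
    and C_min_le_iff: "3 \<le> j \<Longrightarrow> C_min X \<le> j \<longleftrightarrow> cycle_lengths X \<inter> {3..} = {} \<or> cycle_lengths X \<inter> {3..j} \<noteq> {}"
    and C_min_le_small_iff: "j < 3 \<Longrightarrow> C_min X \<le> j \<longleftrightarrow> cycle_lengths X \<inter> {3..} = {}"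
proof -
  have sub: "cycle_lengths X \<subseteq> {3..n}" by (rule cycle_lengths_subset[OF X])
  have fin: "finite (cycle_lengths X)" using sub by (rule finite_subset) simp
  have all: "cycle_lengths X \<inter> {3..} = cycle_lengths X" using sub by auto
  have max: "C_max X \<le> j \<longleftrightarrow> (\<forall>k\<in>cycle_lengths X. k \<le> j)" for j
    using fin by (auto simp: C_max_def)
  have min: "C_min X \<le> j \<longleftrightarrow> cycle_lengths X = {} \<or> (\<exists>k\<in>cycle_lengths X. k \<le> j)" for j
    using fin by (auto simp: C_min_def Min_le_iff)
  show "C_max X \<le> j \<longleftrightarrow> cycle_lengths X \<inter> {j + 1..} = {}"
    unfolding max by (auto simp: disjoint_iff not_less_eq_eq)
  show "C_max X \<le> j \<longleftrightarrow> cycle_lengths X \<inter> {3..} = {}" if "j < 3"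
    unfolding max all using sub that by fastforce
  show "C_min X \<le> j \<longleftrightarrow> cycle_lengths X \<inter> {3..} = {} \<or> cycle_lengths X \<inter> {3..j} \<noteq> {}"
    unfolding min all using sub by fastforce
  show "C_min X \<le> j \<longleftrightarrow> cycle_lengths X \<inter> {3..} = {}" if "j < 3"
    unfolding min all using sub that by fastforce
qed

context weight_law
begin

abbreviation graph_law :: "nat \<Rightarrow> nat set set measure" where
  "graph_law n \<equiv> generalised_random_graph D n"

lemmas graph_law_space = space_generalised_random_graph(2)[OF prob_space_axioms sets_D]

lemma no_cycle_length_estimate:
  assumes "A \<subseteq> {3..}" "0 < n"
  shows "\<bar>measure (graph_law n) {X. cycle_lengths X \<inter> A = {}} - exp (- rate_sum A theta)\<bar> \<le> error_const / real n"
proof -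
  have "measure (graph_law n) {X. cycle_lengths X \<inter> A = {}} =
      measure (graph_law n) {X. \<forall>a\<in>cycles {1..n} A. \<not> a \<subseteq> X}"
    using no_cycle_iff by (intro measure_generalised_random_graph_cong prob_space_axioms sets_D) auto
  thus ?thesis using no_cycle_estimate[OF assms] by simp
qed

lemma longest_cycle_estimate:
  assumes n: "0 < n" and lim: "longest_limit_rv (\<lambda>k. theta ^ k / (2 * real k)) N L"
  shows "kolmogorov_dist (graph_law n) (\<lambda>G. real (C_max G)) N (\<lambda>x. real (L x)) \<le> error_const / real n"
proof (rule kolmogorov_dist_nat_le)
  show "0 \<le> error_const / real n" using error_const_nonneg by simp
  fix j
  interpret N: prob_space N using lim by (simp add: longest_limit_rv_def)
  have L [measurable]: "L \<in> N \<rightarrow>\<^sub>M count_space UNIV" and AE: "AE x in N. L x = 0 \<or> 3 \<le> L x"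
    and L0: "measure N {x \<in> space N. L x = 0} = exp (- rate_sum {3..} theta)"
    and Lj: "3 \<le> j \<Longrightarrow> measure N {x \<in> space N. L x \<le> j} = exp (- rate_sum {j + 1..} theta)"
    using lim by (auto simp: longest_limit_rv_def rate_sum_def)
  define A where "A = (if 3 \<le> j then {j + 1..} else {3..})"
  have "measure (graph_law n) {X \<in> space (graph_law n). C_max X \<le> j} =
      measure (graph_law n) {X. cycle_lengths X \<inter> A = {}}"
    unfolding graph_law_space
    by (intro measure_generalised_random_graph_cong prob_space_axioms sets_D)
      (auto simp: A_def C_max_le_iff C_max_le_small_iff)
  moreover have "measure N {x \<in> space N. L x \<le> j} = exp (- rate_sum A theta)"
  proof (cases "3 \<le> j")
    case False
    have "measure N {x \<in> space N. L x \<le> j} = measure N {x \<in> space N. L x = 0}"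
      by (rule N.finite_measure_eq_AE) (use AE False in \<open>auto elim!: eventually_mono\<close>)
    thus ?thesis using L0 False by (simp add: A_def)
  qed (simp add: A_def Lj)
  ultimately show "\<bar>measure (graph_law n) {X \<in> space (graph_law n). C_max X \<le> j} -
      measure N {x \<in> space N. L x \<le> j}\<bar> \<le> error_const / real n"
    using no_cycle_length_estimate[OF _ n, of A] by (simp add: A_def)
qed

text \<open>A shortest cycle of length at most \<open>j\<close> means that there is no cycle at
  all, or that some cycle has its length in \<open>{3..j}\<close>. These events are disjoint, so
  two instances of the estimate are added.\<close>

lemma shortest_cycle_estimate:
  assumes n: "0 < n" and lim: "shortest_limit_rv (\<lambda>k. theta ^ k / (2 * real k)) N S"
  shows "kolmogorov_dist (graph_law n) (\<lambda>G. real (C_min G)) N (\<lambda>x. real (S x)) \<le> 2 * error_const / real n"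
proof (rule kolmogorov_dist_nat_le)
  show "0 \<le> 2 * error_const / real n" using error_const_nonneg by simp
  fix j
  interpret N: prob_space N using lim by (simp add: shortest_limit_rv_def)
  interpret G: prob_space "graph_law n" by (rule space_generalised_random_graph[OF prob_space_axioms sets_D])
  have S [measurable]: "S \<in> N \<rightarrow>\<^sub>M count_space UNIV" and AE: "AE x in N. S x = 0 \<or> 3 \<le> S x"
    and S0: "measure N {x \<in> space N. S x = 0} = exp (- rate_sum {3..} theta)"
    and Sj: "3 \<le> j \<Longrightarrow> measure N {x \<in> space N. 3 \<le> S x \<and> S x \<le> j} = 1 - exp (- rate_sum {3..j} theta)"
    using lim by (auto simp: shortest_limit_rv_def rate_sum_def)
  let ?P = "measure (graph_law n)" and ?C = "\<lambda>A. {X. cycle_lengths X \<inter> A = {}}"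
  have all: "\<bar>?P (?C {3..}) - exp (- rate_sum {3..} theta)\<bar> \<le> error_const / real n"
    by (rule no_cycle_length_estimate[OF _ n]) simp
  show "\<bar>?P {X \<in> space (graph_law n). C_min X \<le> j} - measure N {x \<in> space N. S x \<le> j}\<bar>
      \<le> 2 * error_const / real n"
  proof (cases "3 \<le> j")
    case True
    have sets: "Y \<in> sets (graph_law n)" for Y
      by (simp add: space_generalised_random_graph[OF prob_space_axioms sets_D])
    have "?P {X \<in> space (graph_law n). C_min X \<le> j} = ?P (?C {3..} \<union> (space (graph_law n) - ?C {3..j}))"
      unfolding graph_law_space
      by (intro measure_generalised_random_graph_cong prob_space_axioms sets_D)
        (auto simp: C_min_le_iff True)
    also have "\<dots> = ?P (?C {3..}) + ?P (space (graph_law n) - ?C {3..j})"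
      by (intro G.finite_measure_Union sets) auto
    also have "?P (space (graph_law n) - ?C {3..j}) = 1 - ?P (?C {3..j})"
      by (intro G.prob_compl sets)
    finally have 1: "?P {X \<in> space (graph_law n). C_min X \<le> j} = ?P (?C {3..}) + (1 - ?P (?C {3..j}))" .
    have "measure N {x \<in> space N. S x \<le> j} =
        measure N ({x \<in> space N. S x = 0} \<union> {x \<in> space N. 3 \<le> S x \<and> S x \<le> j})"
      by (rule N.finite_measure_eq_AE) (use AE in \<open>auto elim!: eventually_mono\<close>)
    also have "\<dots> = measure N {x \<in> space N. S x = 0} + measure N {x \<in> space N. 3 \<le> S x \<and> S x \<le> j}"
      by (intro N.finite_measure_Union) auto
    finally have 2: "measure N {x \<in> space N. S x \<le> j} =
        exp (- rate_sum {3..} theta) + (1 - exp (- rate_sum {3..j} theta))"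
      using S0 Sj[OF True] by simp
    have "\<bar>?P (?C {3..j}) - exp (- rate_sum {3..j} theta)\<bar> \<le> error_const / real n"
      by (rule no_cycle_length_estimate[OF _ n]) auto
    with all show ?thesis unfolding 1 2 by (simp add: abs_le_iff)
  next
    case False
    have "?P {X \<in> space (graph_law n). C_min X \<le> j} = ?P (?C {3..})"
      unfolding graph_law_space
      by (intro measure_generalised_random_graph_cong prob_space_axioms sets_D)
        (use False in \<open>auto simp: C_min_le_small_iff\<close>)
    moreover have "measure N {x \<in> space N. S x \<le> j} = measure N {x \<in> space N. S x = 0}"
      by (rule N.finite_measure_eq_AE) (use AE False in \<open>auto elim!: eventually_mono\<close>)
    moreover have "0 \<le> error_const / real n" using error_const_nonneg by simp
    ultimately show ?thesis using all S0 by simp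
  qed
qed

end

theorem theorem2p5:
  fixes M :: "'a measure" and W :: "'a \<Rightarrow> real"
    and N\<^sub>S :: "'b measure" and S :: "'b \<Rightarrow> nat"
    and N\<^sub>L :: "'c measure" and L :: "'c \<Rightarrow> nat"
  assumes "prob_space M"
    and "W \<in> borel_measurable M"
    and "AE x in M. W x > 0"
    and "integrable M (\<lambda>x. W x ^ 4)"
    and "(\<integral>x. W x ^ 2 \<partial>M) < (\<integral>x. W x \<partial>M)"
    and "shortest_limit_rv (cycle_rate M W) N\<^sub>S S"
    and "longest_limit_rv (cycle_rate M W) N\<^sub>L L"
  shows "(\<exists>C>0. \<forall>n\<ge>3.
            kolmogorov_dist
              (generalised_random_graph (distr M borel W) n) (\<lambda>G. real (C_min G))
              N\<^sub>S (\<lambda>x. real (S x))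
            \<le> C * ln (real n) ^ 3 / real n) \<and>
         (\<exists>C>0. \<forall>n\<ge>3.
            kolmogorov_dist
              (generalised_random_graph (distr M borel W) n) (\<lambda>G. real (C_max G))
              N\<^sub>L (\<lambda>x. real (L x))
            \<le> C * ln (real n) ^ 3 / real n)"
proof -
  let ?D = "distr M borel W"
  note [measurable] = assms(2)
  interpret M: prob_space M by fact
  interpret weight_law ?D
  proof (intro weight_law.intro weight_law_axioms.intro)
    show "prob_space ?D" by (rule M.prob_space_distr) measurable
    show "AE x in ?D. 0 < x" using assms(3) by (subst AE_distr_iff) auto
    show "integrable ?D (\<lambda>x. x ^ 4)" using assms(4) by (subst integrable_distr_eq) auto
    show "(\<integral>x. x\<^sup>2 \<partial>?D) < (\<integral>x. x \<partial>?D)" using assms(5) by (simp add: integral_distr)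
  qed simp
  have rate: "cycle_rate M W = (\<lambda>k. theta ^ k / (2 * real k))"
    by (auto simp: cycle_rate_def theta_def mean_def integral_distr)
  define C where "C = 2 * error_const + 1"
  have C: "0 < C" using error_const_nonneg by (simp add: C_def)
  have scale: "x \<le> C * ln (real n) ^ 3 / real n" if "x \<le> 2 * error_const / real n" "3 \<le> n" for x n
  proof -
    have "exp 1 \<le> real n" using exp_le that(2) by linarith
    hence "1 \<le> ln (real n)" using that(2) by (simp add: ln_ge_iff)
    hence "1 \<le> ln (real n) ^ 3" by (rule one_le_power)
    hence "C * 1 \<le> C * ln (real n) ^ 3" using C by (intro mult_left_mono) auto
    hence "2 * error_const \<le> C * ln (real n) ^ 3" by (simp add: C_def)
    hence "2 * error_const / real n \<le> C * ln (real n) ^ 3 / real n" by (rule divide_right_mono) simp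
    with that(1) show ?thesis by linarith
  qed
  have le2: "error_const / real n \<le> 2 * error_const / real n" for n
    using error_const_nonneg by (intro divide_right_mono) auto
  have "\<forall>n\<ge>3. kolmogorov_dist (graph_law n) (\<lambda>G. real (C_min G)) N\<^sub>S (\<lambda>x. real (S x)) \<le> C * ln (real n) ^ 3 / real n"
    using shortest_cycle_estimate[OF _ assms(6)[unfolded rate]] by (auto intro!: scale)
  moreover have "\<forall>n\<ge>3. kolmogorov_dist (graph_law n) (\<lambda>G. real (C_max G)) N\<^sub>L (\<lambda>x. real (L x)) \<le> C * ln (real n) ^ 3 / real n"
    using order_trans[OF longest_cycle_estimate[OF _ assms(7)[unfolded rate]] le2] by (auto intro!: scale)
  ultimately show ?thesis using C by blast
qed

end
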